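(* Let $(W_n)_{n\ge0}$ be nonnegative random variables, the law of $W_1$ having unbounded support, and let $(T_n)_{n\ge1}$ be real-valued random variables such that $(T_n,W_n)_{n\ge1}$ is i.i.d. and independent of $W_0$. Let $R_0:=W_0$ and $R_n:=\max\{R_{n-1}-T_n,W_n\}$ for $n\ge1$. Assume that $T_1$ is bounded and $E[T_1]>0$. Suppose moreover that there exists $\beta\in(2/3,1)$ such that $\lim_{x\to\infty}x^\beta P[W_1>x]=0$ or $\liminf_{x\to\infty}xP[W_1>x]>E[T_1]$. Let $y\in(0,\infty)$ be such that $P[W_1\le y]>0$. Then $R$ is recurrent if and only if $$\sum_{n\ge0}\prod_{m=0}^nP\left[W_1\le y+mE[T_1]\right]=\infty.$$
   Context: The Markov chain $R=(R_n)_{n\ge0}$ on $[0,\infty)$ (general random exchange process) is called recurrent if there exists $b\in(0,\infty)$ such that $\sum_{n\ge0}P[R_n\le b]=\infty$ for the chain started at $0$ (i.e. with $W_0$ replaced by $0$). (This property does not depend on the initial state.) *)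

theory Defs
  imports "HOL-Probability.Probability"
begin

primrec random_exchange ::
  "(nat \<Rightarrow> 'a \<Rightarrow> real) \<Rightarrow> (nat \<Rightarrow> 'a \<Rightarrow> real) \<Rightarrow> nat \<Rightarrow> 'a \<Rightarrow> real" where
  "random_exchange T W 0 = W 0"
| "random_exchange T W (Suc n) =
     (\<lambda>\<omega>. max (random_exchange T W n \<omega> - T (Suc n) \<omega>) (W (Suc n) \<omega>))"

text \<open>Recurrence is a property of the chain started at \<open>0\<close>, so the initial variable \<open>W 0\<close>
  is overridden. The series is taken in \<^typ>\<open>ennreal\<close>, where it always has a value.\<close>

definition exchange_recurrent ::
  "'a measure \<Rightarrow> (nat \<Rightarrow> 'a \<Rightarrow> real) \<Rightarrow> (nat \<Rightarrow> 'a \<Rightarrow> real) \<Rightarrow> bool" where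
  "exchange_recurrent M T W \<longleftrightarrow>
     (\<exists>b>0. (\<Sum>n. ennreal \<P>(\<omega> in M. random_exchange T (W(0 := (\<lambda>_. 0))) n \<omega> \<le> b)) = \<infinity>)"

definition law_support :: "'b::topological_space measure \<Rightarrow> 'b set" where
  "law_support N = {x. \<forall>U. open U \<longrightarrow> x \<in> U \<longrightarrow> emeasure N U > 0}"

text \<open>The library's \<open>indep_var\<close> forces both variables to have the same type; this is its
  heterogeneous form.\<close>

definition indep_var_hetero ::
  "'a measure \<Rightarrow> 'b measure \<Rightarrow> ('a \<Rightarrow> 'b) \<Rightarrow> 'c measure \<Rightarrow> ('a \<Rightarrow> 'c) \<Rightarrow> bool" where
  "indep_var_hetero M N X K Y \<longleftrightarrow>
     X \<in> measurable M N \<and> Y \<in> measurable M K \<and>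
     prob_space.indep_set M {X -` A \<inter> space M | A. A \<in> sets N} {Y -` B \<inter> space M | B. B \<in> sets K}"

end

theory Submission
  imports Defs "HOL-Real_Asymp.Real_Asymp"
begin

text \<open>
  Reversing time, \<open>R n \<le> b\<close> means that the variables \<open>W (n - k)\<close>, \<open>k < n\<close>, stay below the random
  barriers \<open>b + U k\<close>, where \<open>U k\<close> is the sum of the last \<open>k\<close> of the variables \<open>T\<close>. Up to a
  deviation of order \<open>k powr a\<close> the barrier is \<open>b + k * \<mu>\<close>. A deviation at \<open>k\<close> is
  independent of \<open>W (n - j)\<close> for \<open>j \<ge> k\<close>, so relative to the product of the first \<open>n\<close>
  probabilities it costs Hoeffding's bound divided by the product of the first \<open>k\<close> ones; these
  costs are summable. This compares \<open>P[R n \<le> b]\<close> from both sides with products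
  along perturbed barriers \<open>k * \<mu> \<plusminus> k powr a\<close>, and those agree with the unperturbed product up
  to constants because \<open>E[W powr a]\<close> is finite. For heavy tails a barrier of slightly larger slope
  shows that both series converge.
\<close>

subsection \<open>Real analysis\<close>

text \<open>Weighs a Hoeffding exponent of order \<open>s\<close> against the inverse of a product
  whose logarithm grows with order \<open>t\<close>. As \<open>t < s\<close>, the exponential beats
  \<open>1 / k ^ 2\<close>.\<close>

lemma summable_exp_powr_diff:
  fixes c s t K :: real
  assumes "c > 0" "0 < t" "t < s" "K > 0"
  shows "summable (\<lambda>k::nat. exp (K * (real k + 1) powr t - c * real k powr s))"
proof (rule summable_comparison_test_bigo)
  show "summable (\<lambda>k. norm (1 / real k ^ 2))"
    using inverse_power_summable[of 2, where 'a = real] by (simp add: field_simps)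
  show "(\<lambda>k::nat. exp (K * (real k + 1) powr t - c * real k powr s)) \<in> O(\<lambda>k. 1 / real k ^ 2)"
    using assms by real_asymp
qed

text \<open>Integral comparison in discrete form: by the mean value theorem each summand is at most
  an increment of \<open>x powr (1 - \<beta>) / (1 - \<beta>)\<close>.\<close>

lemma sum_powr_minus_le:
  assumes "0 < \<beta>" "\<beta> < 1"
  shows "(\<Sum>j\<le>k. (real j + 1) powr (- \<beta>)) \<le> (real k + 1) powr (1 - \<beta>) / (1 - \<beta>)"
proof (induction k)
  case 0
  then show ?case using assms by simp
next
  case (Suc k)
  have "\<exists>z. real k + 1 < z \<and> z < real k + 2 \<and>
      (real k + 2) powr (1 - \<beta>) - (real k + 1) powr (1 - \<beta>) =
      (real k + 2 - (real k + 1)) * ((1 - \<beta>) * z powr (- \<beta>))"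
  proof (rule MVT2)
    fix x assume "real k + 1 \<le> x"
    then have "x > 0" by simp
    then show "((\<lambda>x. x powr (1 - \<beta>)) has_real_derivative (1 - \<beta>) * x powr - \<beta>) (at x)"
      using has_real_derivative_powr[of x "1 - \<beta>"] by simp
  qed simp
  then obtain z where z: "real k + 1 < z" "z < real k + 2"
    "(real k + 2) powr (1 - \<beta>) - (real k + 1) powr (1 - \<beta>) = (1 - \<beta>) * z powr (- \<beta>)"
    by auto
  have "(real k + 2) powr (- \<beta>) \<le> z powr (- \<beta>)"
    using z assms by (intro powr_mono2') auto
  then have "(1 - \<beta>) * (real k + 2) powr (- \<beta>) \<le>
      (real k + 2) powr (1 - \<beta>) - (real k + 1) powr (1 - \<beta>)"
    unfolding z(3) using assms by (intro mult_left_mono) auto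
  then have "(real k + 2) powr (- \<beta>) \<le>
      (real k + 2) powr (1 - \<beta>) / (1 - \<beta>) - (real k + 1) powr (1 - \<beta>) / (1 - \<beta>)"
    using assms unfolding diff_divide_distrib[symmetric]
    by (subst pos_le_divide_eq) (simp_all add: mult.commute)
  then show ?case using Suc.IH by (simp add: add.commute)
qed

lemma powr_le_affine:
  assumes "0 < a" "a < 1" "\<nu> > 0"
  shows "\<exists>B\<ge>0. \<forall>j::nat. real j powr a \<le> B + real j * \<nu>"
proof -
  have "eventually (\<lambda>j::nat. real j powr a \<le> real j * \<nu>) sequentially"
    using assms by real_asymp
  then obtain N where N: "\<And>j. j \<ge> N \<Longrightarrow> real j powr a \<le> real j * \<nu>"
    by (auto simp: eventually_sequentially)
  have "real j powr a \<le> real N powr a + real j * \<nu>" for j :: nat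
  proof (cases "j \<ge> N")
    case True
    then show ?thesis using N[of j] by (smt (verit) powr_ge_zero)
  next
    case False
    then have "real j powr a \<le> real N powr a" using assms by (intro powr_mono2) auto
    moreover have "0 \<le> real j * \<nu>" using assms by simp
    ultimately show ?thesis by linarith
  qed
  then show ?thesis by (intro exI[of _ "real N powr a"]) auto
qed

text \<open>The points \<open>j * d\<close> are spaced \<open>d\<close> apart, and those counted lie
  in an interval of length \<open>2 * r\<close>.\<close>

lemma card_near_le:
  fixes x r d :: real
  assumes "d > 0" "r \<ge> 0" "finite J" "\<And>j. j \<in> J \<Longrightarrow> \<bar>x - real j * d\<bar> \<le> r"
  shows "real (card J) \<le> 2 * r / d + 1"
proof (cases "J = {}")
  case True
  then show ?thesis using assms by simp
next
  case False
  have *: "\<bar>x - real (Min J) * d\<bar> \<le> r" "\<bar>x - real (Max J) * d\<bar> \<le> r"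
    using assms(4)[OF Min_in[OF assms(3) False]] assms(4)[OF Max_in[OF assms(3) False]] by auto
  have le: "Min J \<le> Max J" using False assms(3) by (simp add: Min_le_iff)
  have "J \<subseteq> {Min J..Max J}" using assms(3) by auto
  then have "card J \<le> card {Min J..Max J}" by (intro card_mono) auto
  then have "real (card J) \<le> real (Max J) - real (Min J) + 1"
    using le by (simp add: of_nat_diff)
  also have "(real (Max J) - real (Min J)) * d \<le> 2 * r" using * by (simp add: algebra_simps)
  then have "real (Max J) - real (Min J) \<le> 2 * r / d" using assms(1) by (simp add: field_simps)
  finally show ?thesis by simp
qed

lemma suminf_ennreal_eq_infinity_iff:
  assumes "\<And>n. 0 \<le> f n"
  shows "(\<Sum>n. ennreal (f n)) = \<infinity> \<longleftrightarrow> \<not> summable f"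
proof -
  have "summable f \<longleftrightarrow> (\<Sum>n. ennreal (f n)) \<noteq> top"
    using assms summable_suminf_not_top[of f] ennreal_suminf_neq_top[of f] by blast
  then show ?thesis by (simp add: infinity_ennreal_def)
qed

subsection \<open>The backward representation and the union bounds\<close>

text \<open>A maximum is at most \<open>b\<close> iff both arguments are, and the condition on the
  first one is the same problem at time \<open>n\<close> with \<open>b\<close> raised by
  \<open>T (Suc n)\<close>. Hence the induction keeps \<open>b\<close> arbitrary.\<close>

lemma random_exchange_le_iff:
  "random_exchange T W n \<omega> \<le> b \<longleftrightarrow>
     W 0 \<omega> \<le> b + (\<Sum>i\<in>{0<..n}. T i \<omega>) \<and>
     (\<forall>j\<in>{1..n}. W j \<omega> \<le> b + (\<Sum>i\<in>{j<..n}. T i \<omega>))"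
proof (induction n arbitrary: b)
  case 0
  then show ?case by simp
next
  case (Suc n)
  have *: "(\<Sum>i\<in>{j<..Suc n}. T i \<omega>) = T (Suc n) \<omega> + (\<Sum>i\<in>{j<..n}. T i \<omega>)" if "j \<le> n" for j
  proof -
    have "{j<..Suc n} = insert (Suc n) {j<..n}" using that by auto
    then show ?thesis by simp
  qed
  have "random_exchange T W (Suc n) \<omega> \<le> b \<longleftrightarrow>
      random_exchange T W n \<omega> \<le> b + T (Suc n) \<omega> \<and> W (Suc n) \<omega> \<le> b"
    by auto
  also have "\<dots> \<longleftrightarrow> W 0 \<omega> \<le> b + (\<Sum>i\<in>{0<..Suc n}. T i \<omega>) \<and>
      ((\<forall>j\<in>{1..n}. W j \<omega> \<le> b + (\<Sum>i\<in>{j<..Suc n}. T i \<omega>)) \<and> W (Suc n) \<omega> \<le> b)"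
    unfolding Suc.IH by (simp add: * algebra_simps)
  also have "((\<forall>j\<in>{1..n}. W j \<omega> \<le> b + (\<Sum>i\<in>{j<..Suc n}. T i \<omega>)) \<and> W (Suc n) \<omega> \<le> b) \<longleftrightarrow>
      (\<forall>j\<in>{1..Suc n}. W j \<omega> \<le> b + (\<Sum>i\<in>{j<..Suc n}. T i \<omega>))"
    by (auto simp: atLeastAtMostSuc_conv)
  finally show ?case .
qed

locale iid_exchange = prob_space M for M :: "'a measure" +
  fixes T W :: "nat \<Rightarrow> 'a \<Rightarrow> real" and C :: real
  assumes indep_pairs: "indep_vars (\<lambda>_. borel \<Otimes>\<^sub>M borel) (\<lambda>n \<omega>. (T n \<omega>, W n \<omega>)) {1..}"
    and ident_pairs: "n \<ge> 1 \<Longrightarrow>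
      distr M (borel \<Otimes>\<^sub>M borel) (\<lambda>\<omega>. (T n \<omega>, W n \<omega>)) =
      distr M (borel \<Otimes>\<^sub>M borel) (\<lambda>\<omega>. (T 1 \<omega>, W 1 \<omega>))"
    and T1_bounded: "AE \<omega> in M. \<bar>T 1 \<omega>\<bar> \<le> C"
    and C_pos: "C > 0"
begin

definition \<mu> :: real where "\<mu> = expectation (T 1)"

definition F :: "real \<Rightarrow> real" where "F x = \<P>(\<omega> in M. W 1 \<omega> \<le> x)"

definition U :: "nat \<Rightarrow> nat \<Rightarrow> 'a \<Rightarrow> real" where
  "U n k \<omega> = (\<Sum>i\<in>{n - k<..n}. T i \<omega>)"

section \<open>Marginal laws, independence and deviations of the partial sums\<close>

lemma pair_measurable: "n \<ge> 1 \<Longrightarrow> (\<lambda>\<omega>. (T n \<omega>, W n \<omega>)) \<in> measurable M (borel \<Otimes>\<^sub>M borel)"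
  using indep_pairs by (auto simp: indep_vars_def)

lemma T_measurable [measurable]: "n \<ge> 1 \<Longrightarrow> T n \<in> borel_measurable M"
  using measurable_compose[OF pair_measurable measurable_fst] by simp

lemma W_measurable [measurable]: "n \<ge> 1 \<Longrightarrow> W n \<in> borel_measurable M"
  using measurable_compose[OF pair_measurable measurable_snd] by simp

lemma U_measurable [measurable]: "k \<le> n \<Longrightarrow> U n k \<in> borel_measurable M"
  unfolding U_def by (intro borel_measurable_sum) (auto intro!: T_measurable)

lemma distr_T: assumes "n \<ge> 1" shows "distr M borel (T n) = distr M borel (T 1)"
proof -
  have "distr M borel (T n) = distr (distr M (borel \<Otimes>\<^sub>M borel) (\<lambda>\<omega>. (T n \<omega>, W n \<omega>))) borel fst"
    using assms by (subst distr_distr) (auto intro!: pair_measurable simp: o_def)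
  also have "\<dots> = distr M borel (T 1)"
    unfolding ident_pairs[OF assms]
    by (subst distr_distr) (auto intro!: pair_measurable[of 1, simplified] simp: o_def)
  finally show ?thesis .
qed

lemma distr_W: assumes "n \<ge> 1" shows "distr M borel (W n) = distr M borel (W 1)"
proof -
  have "distr M borel (W n) = distr (distr M (borel \<Otimes>\<^sub>M borel) (\<lambda>\<omega>. (T n \<omega>, W n \<omega>))) borel snd"
    using assms by (subst distr_distr) (auto intro!: pair_measurable simp: o_def)
  also have "\<dots> = distr M borel (W 1)"
    unfolding ident_pairs[OF assms]
    by (subst distr_distr) (auto intro!: pair_measurable[of 1, simplified] simp: o_def)
  finally show ?thesis .
qed

lemma prob_W_le: assumes "n \<ge> 1" shows "\<P>(\<omega> in M. W n \<omega> \<le> x) = F x"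
proof -
  have "\<P>(\<omega> in M. W i \<omega> \<le> x) = measure (distr M borel (W i)) {..x}" if "i \<ge> 1" for i
    using that by (subst measure_distr) (auto intro!: arg_cong[where f = prob])
  from this[OF assms] this[of 1] show ?thesis
    by (simp add: F_def distr_W[OF assms])
qed

lemma F_mono: "x \<le> x' \<Longrightarrow> F x \<le> F x'"
  unfolding F_def by (intro finite_measure_mono) auto

lemma F_le_1: "F x \<le> 1"
  unfolding F_def by simp

lemma F_nonneg: "0 \<le> F x"
  unfolding F_def by simp

lemma prob_W_gt: "\<P>(\<omega> in M. W 1 \<omega> > x) = 1 - F x"
proof -
  have "{\<omega> \<in> space M. W 1 \<omega> > x} = space M - {\<omega> \<in> space M. W 1 \<omega> \<le> x}" by auto
  then show ?thesis unfolding F_def using prob_compl[of "{\<omega> \<in> space M. W 1 \<omega> \<le> x}"] by simp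
qed

lemma AE_T_bounded: assumes "n \<ge> 1" shows "AE \<omega> in M. \<bar>T n \<omega>\<bar> \<le> C"
proof -
  have "AE x in distr M borel (T 1). \<bar>x\<bar> \<le> C"
    using T1_bounded by (subst AE_distr_iff) auto
  then have "AE x in distr M borel (T n). \<bar>x\<bar> \<le> C"
    by (simp only: distr_T[OF assms])
  then show ?thesis using assms by (subst (asm) AE_distr_iff) auto
qed

lemma expectation_T: assumes "n \<ge> 1" shows "expectation (T n) = \<mu>"
proof -
  have "expectation (T i) = (\<integral>x. x \<partial>distr M borel (T i))" if "i \<ge> 1" for i
    using that by (subst integral_distr) auto
  from this[OF assms] this[of 1] show ?thesis
    by (simp add: \<mu>_def distr_T[OF assms])
qed

text \<open>\<open>U n k\<close> uses the pairs with index above \<open>n - k\<close>, whereas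
  \<open>W (n - j)\<close> with \<open>j \<ge> k\<close> uses an index of at most
  \<open>n - k\<close>. Disjoint blocks of pairs are independent, although \<open>T i\<close> and
  \<open>W i\<close> of the same pair may depend on each other.\<close>

lemma indep_U_W:
  assumes "k \<le> n" and J: "J \<subseteq> {k..<n}" and B: "B \<in> sets borel"
  shows "\<P>(\<omega> in M. U n k \<omega> \<in> B \<and> (\<forall>j\<in>J. W (n - j) \<omega> \<le> v j)) =
         \<P>(\<omega> in M. U n k \<omega> \<in> B) * (\<Prod>j\<in>J. F (v j))"
proof -
  \<comment> \<open>The label \<open>n\<close> stands for the whole block of \<open>T\<close>
    variables, a label \<open>l < n - k\<close> for the single index \<open>Suc l\<close>. Thus
    \<open>W (n - j)\<close> carries the label \<open>n - Suc j\<close>.\<close>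
  define L where "L = insert n {..<n - k}"
  define K where "K l = (if l = n then {n - k<..n} else {Suc l})" for l
  define Y :: "nat \<Rightarrow> (nat \<Rightarrow> real \<times> real) \<Rightarrow> real"
    where "Y l f = (if l = n then (\<Sum>i\<in>{n - k<..n}. fst (f i)) else snd (f (Suc l)))" for l f
  define X where "X l \<omega> = (if l = n then U n k \<omega> else W (Suc l) \<omega>)" for l \<omega>
  have 1: "indep_vars (\<lambda>j. PiM (K j) (\<lambda>_. borel \<Otimes>\<^sub>M borel))
      (\<lambda>l \<omega>. restrict (\<lambda>i. (T i \<omega>, W i \<omega>)) (K l)) L"
    by (rule indep_vars_restrict[OF indep_pairs])
       (auto simp: L_def K_def disjoint_family_on_def)
  have comp: "(\<lambda>f. f i) \<in> measurable (PiM I (\<lambda>_. borel \<Otimes>\<^sub>M (borel :: real measure)))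
      ((borel :: real measure) \<Otimes>\<^sub>M borel)" if "i \<in> I" for i :: nat and I
    using that by (rule measurable_component_singleton)
  have 2: "indep_vars (\<lambda>_. borel) (\<lambda>l \<omega>. Y l (restrict (\<lambda>i. (T i \<omega>, W i \<omega>)) (K l))) L"
  proof (rule indep_vars_compose2[OF 1])
    fix l assume "l \<in> L"
    show "Y l \<in> measurable (PiM (K l) (\<lambda>_. borel \<Otimes>\<^sub>M borel)) borel"
    proof (cases "l = n")
      case True
      have "(\<lambda>f :: nat \<Rightarrow> real \<times> real. \<Sum>i\<in>{n - k<..n}. fst (f i)) \<in>
          borel_measurable (PiM {n - k<..n} (\<lambda>_. borel \<Otimes>\<^sub>M borel))"
      proof (rule borel_measurable_sum)
        fix i assume "i \<in> {n - k<..n}"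
        then show "(\<lambda>f :: nat \<Rightarrow> real \<times> real. fst (f i)) \<in>
            borel_measurable (PiM {n - k<..n} (\<lambda>_. borel \<Otimes>\<^sub>M borel))"
          by (rule measurable_compose[OF comp measurable_fst])
      qed
      then show ?thesis unfolding Y_def K_def by (simp only: True if_True simp_thms)
    next
      case False
      have "(\<lambda>f :: nat \<Rightarrow> real \<times> real. snd (f (Suc l))) \<in>
          borel_measurable (PiM {Suc l} (\<lambda>_. borel \<Otimes>\<^sub>M borel))"
        by (rule measurable_compose[OF comp measurable_snd]) simp
      then show ?thesis unfolding Y_def K_def by (simp only: False if_False simp_thms)
    qed
  qed
  have 3: "(\<lambda>l \<omega>. Y l (restrict (\<lambda>i. (T i \<omega>, W i \<omega>)) (K l))) = X"
    unfolding Y_def K_def X_def U_def fun_eq_iff by simp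
  have X: "indep_vars (\<lambda>_. borel) X L" using 2 unfolding 3 .
  have J_bounds: "k \<le> j" "j < n" if "j \<in> J" for j using that J by auto
  define J' where "J' = (\<lambda>j. n - Suc j) ` J"
  have inj: "inj_on (\<lambda>j. n - Suc j) J" by (intro inj_onI) (auto dest!: J_bounds(2))
  have finJ: "finite J" using J by (rule finite_subset) simp
  have nJ': "n \<notin> J'" by (auto simp: J'_def dest!: J_bounds(2))
  have J'L: "insert n J' \<subseteq> L"
  proof -
    have "n - Suc j < n - k" if "j \<in> J" for j using J_bounds[OF that] by linarith
    then show ?thesis by (auto simp: J'_def L_def)
  qed
  define A where "A l = (if l = n then B else {..v (n - Suc l)})" for l
  have XJ: "X (n - Suc j) \<omega> = W (n - j) \<omega>" "A (n - Suc j) = {..v j}" if "j \<in> J" for j \<omega>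
  proof -
    have "j < n" using that by (rule J_bounds)
    then show "X (n - Suc j) \<omega> = W (n - j) \<omega>" "A (n - Suc j) = {..v j}"
      by (auto simp: X_def A_def Suc_diff_Suc)
  qed
  have eq: "(\<Inter>l\<in>insert n J'. X l -` A l \<inter> space M) =
      {\<omega> \<in> space M. U n k \<omega> \<in> B \<and> (\<forall>j\<in>J. W (n - j) \<omega> \<le> v j)}"
    unfolding J'_def by (auto simp: XJ) (auto simp: X_def A_def)
  have "prob (\<Inter>l\<in>insert n J'. X l -` A l \<inter> space M) =
      (\<Prod>l\<in>insert n J'. prob (X l -` A l \<inter> space M))"
    by (rule indep_varsD[OF X]) (use finJ J'L B in \<open>auto simp: J'_def A_def\<close>)
  also have "\<dots> = prob (X n -` A n \<inter> space M) * (\<Prod>l\<in>J'. prob (X l -` A l \<inter> space M))"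
    using finJ nJ' by (subst prod.insert) (auto simp: J'_def)
  also have "prob (X n -` A n \<inter> space M) = \<P>(\<omega> in M. U n k \<omega> \<in> B)"
    by (rule arg_cong[where f = prob]) (auto simp: X_def A_def)
  also have "(\<Prod>l\<in>J'. prob (X l -` A l \<inter> space M)) =
      (\<Prod>j\<in>J. prob (X (n - Suc j) -` A (n - Suc j) \<inter> space M))"
    unfolding J'_def using inj by (subst prod.reindex) auto
  also have "\<dots> = (\<Prod>j\<in>J. F (v j))"
  proof (rule prod.cong[OF refl])
    fix j assume j: "j \<in> J"
    have "X (n - Suc j) -` A (n - Suc j) \<inter> space M = {\<omega> \<in> space M. W (n - j) \<omega> \<le> v j}"
      using j by (auto simp: XJ)
    moreover have "n - j \<ge> 1" using J_bounds(2)[OF j] by linarith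
    ultimately show "prob (X (n - Suc j) -` A (n - Suc j) \<inter> space M) = F (v j)"
      using prob_W_le by simp
  qed
  finally show ?thesis unfolding eq .
qed

corollary prob_W_le_all:
  "\<P>(\<omega> in M. \<forall>j<n. W (n - j) \<omega> \<le> v j) = (\<Prod>j<n. F (v j))"
  using indep_U_W[of 0 n "{..<n}" UNIV v] by (simp add: prob_space atLeast0LessThan Ball_def)

text \<open>Hoeffding's inequality for \<open>k\<close> independent variables with values in
  \<open>[-C, C]\<close>; the squared ranges add up to \<open>4 * C\<^sup>2 * k\<close>.\<close>

lemma U_deviation:
  assumes "k \<le> n" "\<epsilon> \<ge> 0"
  shows "\<P>(\<omega> in M. U n k \<omega> \<ge> real k * \<mu> + \<epsilon>) \<le> exp (- \<epsilon>\<^sup>2 / (2 * C\<^sup>2 * real k))"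
    and "\<P>(\<omega> in M. U n k \<omega> \<le> real k * \<mu> - \<epsilon>) \<le> exp (- \<epsilon>\<^sup>2 / (2 * C\<^sup>2 * real k))"
proof -
  let ?I = "{n - k<..n}"
  have "indep_vars (\<lambda>_. borel) (\<lambda>i \<omega>. fst (T i \<omega>, W i \<omega>)) ?I"
    by (rule indep_vars_compose2[OF indep_vars_subset[OF indep_pairs]]) auto
  then have ind: "indep_vars (\<lambda>_. borel) T ?I" by simp
  interpret Hoeffding_ineq M ?I T "\<lambda>_. - C" "\<lambda>_. C" "\<Sum>i\<in>?I. expectation (T i)"
  proof unfold_locales
    fix i assume "i \<in> ?I"
    then have "AE x in M. \<bar>T i x\<bar> \<le> C" by (intro AE_T_bounded) auto
    then show "AE x in M. T i x \<in> {- C..C}" by eventually_elim auto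
  qed (use ind in auto)
  have \<mu>: "(\<Sum>i\<in>?I. expectation (T i)) = real k * \<mu>"
    using assms(1) by (simp add: expectation_T)
  have s: "(\<Sum>i\<in>?I. (C - - C)\<^sup>2) = 4 * C\<^sup>2 * real k"
    using assms(1) by (simp add: power2_eq_square)
  have "\<P>(\<omega> in M. U n k \<omega> \<ge> real k * \<mu> + \<epsilon>) \<le> exp (- \<epsilon>\<^sup>2 / (2 * C\<^sup>2 * real k)) \<and>
        \<P>(\<omega> in M. U n k \<omega> \<le> real k * \<mu> - \<epsilon>) \<le> exp (- \<epsilon>\<^sup>2 / (2 * C\<^sup>2 * real k))"
  \<comment> \<open>Hoeffding's inequality asks for a positive sum of squared ranges. For
    \<open>k = 0\<close> division by zero makes the right-hand side
    \<open>exp 0 = 1\<close>.\<close>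
  proof (cases "k = 0")
    case True
    then show ?thesis by simp
  next
    case False
    have "(\<Sum>i\<in>?I. (C - - C)\<^sup>2) > 0" using s False C_pos by simp
    from Hoeffding_ineq_ge[OF assms(2) this] Hoeffding_ineq_le[OF assms(2) this]
    show ?thesis unfolding \<mu> s U_def by (simp add: mult_ac)
  qed
  then show "\<P>(\<omega> in M. U n k \<omega> \<ge> real k * \<mu> + \<epsilon>) \<le> exp (- \<epsilon>\<^sup>2 / (2 * C\<^sup>2 * real k))"
    and "\<P>(\<omega> in M. U n k \<omega> \<le> real k * \<mu> - \<epsilon>) \<le> exp (- \<epsilon>\<^sup>2 / (2 * C\<^sup>2 * real k))" by blast+
qed

text \<open>Rules out deviations at small \<open>k\<close> entirely once \<open>b\<close> is large,
  where Hoeffding's bound would be too weak.\<close>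

lemma AE_U_ge: assumes "k \<le> n" shows "AE \<omega> in M. U n k \<omega> \<ge> - C * real k"
proof -
  have "AE \<omega> in M. \<forall>i\<in>{n - k<..n}. \<bar>T i \<omega>\<bar> \<le> C"
    by (rule AE_finite_allI) (auto intro!: AE_T_bounded)
  then show ?thesis
  proof eventually_elim
    case (elim \<omega>)
    have "(\<Sum>i\<in>{n - k<..n}. - C) \<le> U n k \<omega>"
      unfolding U_def using elim by (intro sum_mono) force
    then show ?case using assms by (simp add: mult.commute)
  qed
qed

section \<open>Union bounds for the return probabilities\<close>

definition return_prob :: "real \<Rightarrow> nat \<Rightarrow> real" where
  "return_prob b n = \<P>(\<omega> in M. random_exchange T (W(0 := (\<lambda>_. 0))) n \<omega> \<le> b)"

lemma random_exchange_le_iff_U: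
  "random_exchange T (W(0 := (\<lambda>_. 0))) n \<omega> \<le> b \<longleftrightarrow>
     0 \<le> b + U n n \<omega> \<and> (\<forall>k<n. W (n - k) \<omega> \<le> b + U n k \<omega>)"
proof -
  have "(\<forall>j\<in>{1..n}. W j \<omega> \<le> b + (\<Sum>i\<in>{j<..n}. T i \<omega>)) \<longleftrightarrow> (\<forall>k<n. W (n - k) \<omega> \<le> b + U n k \<omega>)"
  proof (intro iffI ballI allI impI)
    fix j assume *: "\<forall>k<n. W (n - k) \<omega> \<le> b + U n k \<omega>" and j: "j \<in> {1..n}"
    show "W j \<omega> \<le> b + (\<Sum>i\<in>{j<..n}. T i \<omega>)"
      using *[rule_format, of "n - j"] j by (auto simp: U_def)
  qed (auto simp: U_def)
  then show ?thesis
    unfolding random_exchange_le_iff by (auto simp: U_def)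
qed

lemma W_all_le_event:
  assumes "J \<subseteq> {..<n}"
  shows "{\<omega> \<in> space M. \<forall>j\<in>J. W (n - j) \<omega> \<le> v j} \<in> events"
proof (rule sets.sets_Collect_finite_All)
  show "finite J" using assms by (rule finite_subset) simp
  fix j assume "j \<in> J"
  then have "n - j \<ge> 1" using assms by auto
  then show "{\<omega> \<in> space M. W (n - j) \<omega> \<le> v j} \<in> events" by simp
qed

lemma random_exchange_measurable [measurable]:
  "random_exchange T (W(0 := (\<lambda>_. 0))) n \<in> borel_measurable M"
  by (induction n) auto

text \<open>Split according to the last \<open>k\<close> with \<open>U n k > h k\<close>: after it the barrier \<open>b + U n j\<close> is
  below the deterministic one, and \<open>U n k\<close> is independent of the remaining \<open>W (n - j)\<close>.\<close>

lemma return_prob_upper: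
  assumes q: "\<And>j. F (b + h j) \<le> q j" "\<And>j. q j > 0"
    and \<delta>: "\<And>n k. k \<le> n \<Longrightarrow> \<P>(\<omega> in M. U n k \<omega> > h k) \<le> \<delta> k"
  shows "return_prob b n \<le> (\<Prod>j<n. q j) * (1 + (\<Sum>k<n. \<delta> k / (\<Prod>j\<le>k. q j)))"
proof -
  let ?A = "{\<omega> \<in> space M. \<forall>j<n. W (n - j) \<omega> \<le> b + h j}"
  let ?B = "\<lambda>k. {\<omega> \<in> space M. U n k \<omega> \<in> {h k<..} \<and> (\<forall>j\<in>{k<..<n}. W (n - j) \<omega> \<le> b + h j)}"
  have mA: "?A \<in> events"
    using W_all_le_event[of "{..<n}" n "\<lambda>j. b + h j"] by (simp add: Ball_def)
  have mB: "?B k \<in> events" if "k < n" for k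
    using that by (intro sets.sets_Collect_conj W_all_le_event) auto
  have mUB: "(\<Union>k<n. ?B k) \<in> events"
    by (intro sets.finite_UN mB) auto
  have sub: "{\<omega> \<in> space M. random_exchange T (W(0 := (\<lambda>_. 0))) n \<omega> \<le> b} \<subseteq> ?A \<union> (\<Union>k<n. ?B k)"
  proof
    fix \<omega> assume "\<omega> \<in> {\<omega> \<in> space M. random_exchange T (W(0 := (\<lambda>_. 0))) n \<omega> \<le> b}"
    then have \<omega>: "\<omega> \<in> space M" and W: "\<And>k. k < n \<Longrightarrow> W (n - k) \<omega> \<le> b + U n k \<omega>"
      by (auto simp: random_exchange_le_iff_U)
    let ?D = "{k. k < n \<and> U n k \<omega> > h k}"
    show "\<omega> \<in> ?A \<union> (\<Union>k<n. ?B k)"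
    proof (cases "?D = {}")
      case True
      have "W (n - j) \<omega> \<le> b + h j" if "j < n" for j
      proof -
        have "\<not> U n j \<omega> > h j" using True that by blast
        then show ?thesis using W[OF that] by linarith
      qed
      then show ?thesis using \<omega> by auto
    next
      case False
      define k where "k = Max ?D"
      have k: "k \<in> ?D" unfolding k_def using False by (intro Max_in) auto
      have "W (n - j) \<omega> \<le> b + h j" if "j \<in> {k<..<n}" for j
      proof -
        have "j \<notin> ?D"
        proof
          assume "j \<in> ?D"
          then have "j \<le> k" unfolding k_def by (intro Max_ge) auto
          then show False using that by auto
        qed
        then show ?thesis using W[of j] that by auto
      qed
      then show ?thesis using \<omega> k by auto
    qed
  qed
  have "return_prob b n \<le> prob (?A \<union> (\<Union>k<n. ?B k))"
    unfolding return_prob_def by (intro finite_measure_mono[OF sub] sets.Un mA mUB)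
  also have "\<dots> \<le> prob ?A + prob (\<Union>k<n. ?B k)"
    by (intro measure_subadditive mA mUB) auto
  also have "prob (\<Union>k<n. ?B k) \<le> (\<Sum>k<n. prob (?B k))"
    by (intro finite_measure_subadditive_finite image_subsetI mB) auto
  also have "prob ?A = (\<Prod>j<n. F (b + h j))" by (rule prob_W_le_all)
  also have "(\<Prod>j<n. F (b + h j)) \<le> (\<Prod>j<n. q j)"
    using q(1) F_nonneg by (intro prod_mono) auto
  \<comment> \<open>Independence leaves only the factors with \<open>j > k\<close>. Restoring the
    full product costs a division by the factors up to \<open>k\<close>.\<close>
  also have "(\<Sum>k<n. prob (?B k)) \<le> (\<Sum>k<n. (\<Prod>j<n. q j) * (\<delta> k / (\<Prod>j\<le>k. q j)))"
  proof (rule sum_mono)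
    fix k assume "k \<in> {..<n}"
    then have k: "k < n" by simp
    have "prob (?B k) = \<P>(\<omega> in M. U n k \<omega> \<in> {h k<..}) * (\<Prod>j\<in>{k<..<n}. F (b + h j))"
      using k by (intro indep_U_W) auto
    also have "\<dots> \<le> \<delta> k * (\<Prod>j\<in>{k<..<n}. q j)"
      using \<delta>[of k n] k q(1) F_nonneg
      by (intro mult_mono prod_mono prod_nonneg) (auto intro: order_trans[OF measure_nonneg])
    also have "(\<Prod>j<n. q j) = (\<Prod>j\<le>k. q j) * (\<Prod>j\<in>{k<..<n}. q j)"
    proof -
      have "{..<n} = {..k} \<union> {k<..<n}" using k by auto
      then show ?thesis by (simp add: prod.union_disjoint[symmetric] ivl_disj_int)
    qed
    then have "\<delta> k * (\<Prod>j\<in>{k<..<n}. q j) = (\<Prod>j<n. q j) * (\<delta> k / (\<Prod>j\<le>k. q j))"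
      using q(2) by (simp add: prod_pos less_imp_neq[symmetric])
    finally show "prob (?B k) \<le> (\<Prod>j<n. q j) * (\<delta> k / (\<Prod>j\<le>k. q j))" .
  qed
  finally show ?thesis by (simp add: algebra_simps sum_distrib_left)
qed

text \<open>If every \<open>W (n - j)\<close> is below \<open>v j\<close> but the chain ends above
  \<open>b\<close>, then \<open>U n k < v k - b\<close> for some \<open>k \<le> n\<close>. For each
  such \<open>k\<close> only the constraints with \<open>j \<ge> k\<close> are kept, which are
  independent of \<open>U n k\<close>. The index \<open>k = n\<close> belongs to the start value
  \<open>0\<close>, and there \<open>v n \<ge> 0\<close> is used.\<close>

lemma return_prob_lower:
  assumes v: "\<And>j. v j \<ge> 0" "\<And>j. F (v j) > 0"
    and \<delta>: "\<And>n k. k \<le> n \<Longrightarrow> \<P>(\<omega> in M. U n k \<omega> < v k - b) \<le> \<delta> k"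
  shows "return_prob b n \<ge> (\<Prod>j<n. F (v j)) * (1 - (\<Sum>k\<le>n. \<delta> k / (\<Prod>j<k. F (v j))))"
proof -
  let ?R = "{\<omega> \<in> space M. random_exchange T (W(0 := (\<lambda>_. 0))) n \<omega> \<le> b}"
  let ?A = "{\<omega> \<in> space M. \<forall>j<n. W (n - j) \<omega> \<le> v j}"
  let ?B = "\<lambda>k. {\<omega> \<in> space M. U n k \<omega> \<in> {..<v k - b} \<and> (\<forall>j\<in>{k..<n}. W (n - j) \<omega> \<le> v j)}"
  have mR: "?R \<in> events" by measurable
  have mB: "?B k \<in> events" if "k \<le> n" for k
    using that by (intro sets.sets_Collect_conj W_all_le_event) auto
  have mUB: "(\<Union>k\<le>n. ?B k) \<in> events"
    by (intro sets.finite_UN mB) auto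
  have sub: "?A \<subseteq> ?R \<union> (\<Union>k\<le>n. ?B k)"
  proof
    fix \<omega> assume "\<omega> \<in> ?A"
    then have \<omega>: "\<omega> \<in> space M" and W: "\<And>k. k < n \<Longrightarrow> W (n - k) \<omega> \<le> v k" by auto
    show "\<omega> \<in> ?R \<union> (\<Union>k\<le>n. ?B k)"
    proof (cases "\<exists>k\<le>n. U n k \<omega> < v k - b")
      case True
      then show ?thesis using \<omega> W by auto
    next
      case False
      then have *: "v k \<le> b + U n k \<omega>" if "k \<le> n" for k
        using that by (auto simp: not_less algebra_simps)
      have "0 \<le> b + U n n \<omega>" using *[of n] v(1)[of n] by simp
      moreover have "W (n - k) \<omega> \<le> b + U n k \<omega>" if "k < n" for k
        using *[of k] W[OF that] that by simp
      ultimately show ?thesis using \<omega> by (auto simp: random_exchange_le_iff_U)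
    qed
  qed
  have "(\<Prod>j<n. F (v j)) = prob ?A" by (rule prob_W_le_all[symmetric])
  also have "\<dots> \<le> prob (?R \<union> (\<Union>k\<le>n. ?B k))"
    by (intro finite_measure_mono[OF sub] sets.Un mR mUB)
  also have "\<dots> \<le> prob ?R + prob (\<Union>k\<le>n. ?B k)"
    by (intro measure_subadditive mR mUB) auto
  also have "prob (\<Union>k\<le>n. ?B k) \<le> (\<Sum>k\<le>n. prob (?B k))"
    by (intro finite_measure_subadditive_finite image_subsetI mB) auto
  also have "(\<Sum>k\<le>n. prob (?B k)) \<le> (\<Sum>k\<le>n. (\<Prod>j<n. F (v j)) * (\<delta> k / (\<Prod>j<k. F (v j))))"
  proof (rule sum_mono)
    fix k assume "k \<in> {..n}"
    then have k: "k \<le> n" by simp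
    have "prob (?B k) = \<P>(\<omega> in M. U n k \<omega> \<in> {..<v k - b}) * (\<Prod>j\<in>{k..<n}. F (v j))"
      using k by (intro indep_U_W) auto
    also have "\<dots> \<le> \<delta> k * (\<Prod>j\<in>{k..<n}. F (v j))"
      using \<delta>[of k n] k F_nonneg by (intro mult_right_mono prod_nonneg) auto
    also have "(\<Prod>j<n. F (v j)) = (\<Prod>j<k. F (v j)) * (\<Prod>j\<in>{k..<n}. F (v j))"
    proof -
      have "{..<n} = {..<k} \<union> {k..<n}" using k by auto
      then show ?thesis by (simp add: prod.union_disjoint[symmetric] ivl_disj_int)
    qed
    then have "\<delta> k * (\<Prod>j\<in>{k..<n}. F (v j)) = (\<Prod>j<n. F (v j)) * (\<delta> k / (\<Prod>j<k. F (v j)))"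
      using v(2) by (simp add: prod_pos less_imp_neq[symmetric])
    finally show "prob (?B k) \<le> (\<Prod>j<n. F (v j)) * (\<delta> k / (\<Prod>j<k. F (v j)))" .
  qed
  finally show ?thesis
    unfolding return_prob_def[symmetric] by (simp add: algebra_simps sum_distrib_left)
qed

subsection \<open>Light tails\<close>

definition light_tail :: "real \<Rightarrow> bool" where
  "light_tail \<beta> \<longleftrightarrow> ((\<lambda>x. x powr \<beta> * (1 - F x)) \<longlongrightarrow> 0) at_top"

lemma tail_powr_bound:
  assumes "light_tail \<beta>" "0 < \<beta>"
  obtains K where "K > 0" "\<And>x. x > 0 \<Longrightarrow> 1 - F x \<le> K * x powr (- \<beta>)"
proof -
  have "eventually (\<lambda>x. x powr \<beta> * (1 - F x) < 1) at_top"
    using assms(1) unfolding light_tail_def by (rule order_tendstoD) simp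
  then obtain x0 where x0: "\<And>x. x \<ge> x0 \<Longrightarrow> x powr \<beta> * (1 - F x) < 1"
    by (auto simp: eventually_at_top_linorder)
  \<comment> \<open>The bound \<open>1\<close> serves beyond \<open>x0\<close>; below
    \<open>x0\<close> the tail is at most \<open>1\<close> and \<open>x powr \<beta>\<close> at most
    \<open>x0 powr \<beta>\<close>.\<close>
  define K where "K = max 1 (x0 powr \<beta>)"
  have "1 - F x \<le> K * x powr (- \<beta>)" if "x > 0" for x
  proof -
    have "x powr \<beta> * (1 - F x) \<le> K"
    proof (cases "x \<ge> x0")
      case True
      then show ?thesis using x0[OF True] by (simp add: K_def)
    next
      case False
      have "x powr \<beta> * (1 - F x) \<le> x0 powr \<beta> * 1"
        using False that assms(2) F_nonneg F_le_1
        by (intro mult_mono powr_mono2) (auto simp: F_nonneg F_le_1)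
      then show ?thesis by (simp add: K_def)
    qed
    then show ?thesis using that by (simp add: powr_minus field_simps)
  qed
  then show thesis by (intro that[of K]) (auto simp: K_def)
qed

text \<open>A deviation of order \<open>k powr a\<close> of the partial sums costs \<open>exp (- c * k powr (2 * a - 1))\<close>,
  whereas the product below decays at most like \<open>exp (- K * k powr (1 - \<beta>))\<close>. This forces
  \<open>a > 1 - \<beta> / 2\<close>; since also \<open>a < \<beta>\<close> will be needed, it is the origin of \<open>\<beta> > 2 / 3\<close>.\<close>

lemma summable_deviation_ratio:
  assumes tail: "light_tail \<beta>" and \<beta>: "0 < \<beta>" "\<beta> < 1" and a: "1 - \<beta> < 2 * a - 1"
    and y: "y > 0" "F y > 0" and "\<nu> > 0" "c > 0"
  shows "summable (\<lambda>k. exp (- c * real k powr (2 * a - 1)) / (\<Prod>j\<le>k. F (y + real j * \<nu>)))"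
proof -
  obtain K where K: "K > 0" "\<And>x. x > 0 \<Longrightarrow> 1 - F x \<le> K * x powr (- \<beta>)"
    using tail_powr_bound[OF tail \<beta>(1)] by blast
  \<comment> \<open>The choice gives \<open>y + j * \<nu> \<ge> m * (j + 1)\<close>, so the tails
    along the barrier are bounded by multiples of \<open>(j + 1) powr (- \<beta>)\<close>.\<close>
  define m where "m = min y \<nu>"
  have m: "m > 0" using y \<open>\<nu> > 0\<close> by (simp add: m_def)
  have Fy: "F (y + real j * \<nu>) \<ge> F y" for j :: nat
    using \<open>\<nu> > 0\<close> by (intro F_mono) auto
  have Fpos: "F (y + real j * \<nu>) > 0" for j :: nat using Fy y(2) by (rule less_le_trans[rotated])
  define K' where "K' = K * m powr (- \<beta>) / F y / (1 - \<beta>)"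
  have K': "K' > 0" using K m y \<beta> by (simp add: K'_def)
  have inv: "1 / F (y + real j * \<nu>) \<le> exp (K * m powr (- \<beta>) / F y * (real j + 1) powr (- \<beta>))" for j
  proof -
    let ?x = "y + real j * \<nu>"
    have mj: "m * (real j + 1) \<le> ?x" "m * (real j + 1) > 0"
    proof -
      have "m * real j \<le> real j * \<nu>"
        by (subst mult.commute, intro mult_left_mono) (auto simp: m_def)
      moreover have "m \<le> y" by (simp add: m_def)
      ultimately show "m * (real j + 1) \<le> ?x" by (simp add: algebra_simps)
    qed (use m in auto)
    have "1 - F ?x \<le> K * ?x powr (- \<beta>)" using K(2)[of ?x] mj by linarith
    also have "?x powr (- \<beta>) \<le> (m * (real j + 1)) powr (- \<beta>)"
      using mj \<beta> by (intro powr_mono2') auto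
    also have "\<dots> = m powr (- \<beta>) * (real j + 1) powr (- \<beta>)" using m by (simp add: powr_mult)
    finally have G: "1 - F ?x \<le> K * m powr (- \<beta>) * (real j + 1) powr (- \<beta>)"
      using K(1) by simp
    \<comment> \<open>Writing the inverse as one plus a small term allows
      \<open>1 + z \<le> exp z\<close>, which turns the product into the exponential of a sum. The
      denominator is bounded below by \<open>F y\<close>.\<close>
    have "1 / F ?x = 1 + (1 - F ?x) / F ?x" using Fpos[of j] by (simp add: field_simps)
    also have "(1 - F ?x) / F ?x \<le> (1 - F ?x) / F y"
      using Fy[of j] y(2) F_le_1[of ?x] by (intro divide_left_mono) auto
    also have "(1 - F ?x) / F y \<le> K * m powr (- \<beta>) * (real j + 1) powr (- \<beta>) / F y"
      using G y(2) by (intro divide_right_mono) auto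
    finally have "1 / F ?x \<le> 1 + K * m powr (- \<beta>) / F y * (real j + 1) powr (- \<beta>)"
      by simp
    also have "\<dots> \<le> exp (K * m powr (- \<beta>) / F y * (real j + 1) powr (- \<beta>))"
      by (rule exp_ge_add_one_self)
    finally show ?thesis .
  qed
  have bound: "1 / (\<Prod>j\<le>k. F (y + real j * \<nu>)) \<le> exp (K' * (real k + 1) powr (1 - \<beta>))" for k
  proof -
    have "1 / (\<Prod>j\<le>k. F (y + real j * \<nu>)) = (\<Prod>j\<le>k. 1 / F (y + real j * \<nu>))"
      by (simp add: prod_dividef)
    also have "\<dots> \<le> (\<Prod>j\<le>k. exp (K * m powr (- \<beta>) / F y * (real j + 1) powr (- \<beta>)))"
      by (intro prod_mono) (use inv F_nonneg in auto)
    also have "\<dots> = exp (K * m powr (- \<beta>) / F y * (\<Sum>j\<le>k. (real j + 1) powr (- \<beta>)))"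
      by (simp add: exp_sum sum_distrib_left)
    also have "\<dots> \<le> exp (K * m powr (- \<beta>) / F y * ((real k + 1) powr (1 - \<beta>) / (1 - \<beta>)))"
      unfolding exp_le_cancel_iff
      using K(1) y(2) by (intro mult_left_mono sum_powr_minus_le \<beta>) auto
    finally show ?thesis by (simp add: K'_def)
  qed
  show ?thesis
  proof (rule summable_comparison_test'[where N = 0])
    show "summable (\<lambda>k::nat. exp (K' * (real k + 1) powr (1 - \<beta>) - c * real k powr (2 * a - 1)))"
      using assms K' by (intro summable_exp_powr_diff) auto
    fix k :: nat
    have "norm (exp (- c * real k powr (2 * a - 1)) / (\<Prod>j\<le>k. F (y + real j * \<nu>))) =
        exp (- c * real k powr (2 * a - 1)) * (1 / (\<Prod>j\<le>k. F (y + real j * \<nu>)))"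
      using F_nonneg by (simp add: prod_nonneg)
    also have "\<dots> \<le> exp (- c * real k powr (2 * a - 1)) * exp (K' * (real k + 1) powr (1 - \<beta>))"
      using bound[of k] by (intro mult_left_mono) auto
    finally show "norm (exp (- c * real k powr (2 * a - 1)) / (\<Prod>j\<le>k. F (y + real j * \<nu>))) \<le>
        exp (K' * (real k + 1) powr (1 - \<beta>) - c * real k powr (2 * a - 1))"
      by (simp add: exp_add[symmetric])
  qed
qed

section \<open>Fractional moments and products along perturbed barriers\<close>

lemma integrable_W_powr:
  assumes tail: "light_tail \<beta>" and a: "0 < a" "a < \<beta>"
  shows "integrable M (\<lambda>\<omega>. max 0 (W 1 \<omega>) powr a)"
proof -
  obtain K where K: "K > 0" "\<And>x. x > 0 \<Longrightarrow> 1 - F x \<le> K * x powr (- \<beta>)"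
    using tail_powr_bound[OF tail] a by auto
  have [measurable]: "W (Suc 0) \<in> borel_measurable M" using W_measurable[of 1] by simp
  \<comment> \<open>Rounding up gives a natural number, whose expectation is the sum of its tails
    \<open>P[f > t]\<close>. These are of order \<open>t powr (- \<beta> / a)\<close> with
    \<open>\<beta> / a > 1\<close>.\<close>
  define f where "f \<omega> = nat \<lceil>max 0 (W 1 \<omega>) powr a\<rceil>" for \<omega>
  have "(\<integral>\<^sup>+\<omega>. ennreal (norm (max 0 (W 1 \<omega>) powr a)) \<partial>M) \<le> (\<integral>\<^sup>+\<omega>. of_nat (f \<omega>) \<partial>M)"
  proof (rule nn_integral_mono)
    fix \<omega>
    have "norm (max 0 (W 1 \<omega>) powr a) \<le> real (f \<omega>)"
      unfolding f_def by (simp add: real_nat_ceiling_ge)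
    then show "ennreal (norm (max 0 (W 1 \<omega>) powr a)) \<le> of_nat (f \<omega>)"
      by (simp add: ennreal_of_nat_eq_real_of_nat ennreal_leI)
  qed
  also have "\<dots> = (\<Sum>t. emeasure M {\<omega> \<in> space M. t < f \<omega>})"
    by (intro nn_integral_nat_function) (simp add: f_def)
  \<comment> \<open>The term \<open>t = 0\<close> needs its own bound, since \<open>0 powr _\<close>
    is \<open>0\<close>.\<close>
  also have "\<dots> \<le> (\<Sum>t. ennreal (if t = 0 then 1 else K * real t powr (- \<beta> / a)))"
  proof (intro suminf_le)
    fix t
    show "emeasure M {\<omega> \<in> space M. t < f \<omega>} \<le> ennreal (if t = 0 then 1 else K * real t powr (- \<beta> / a))"
    proof (cases "t = 0")
      case True
      then show ?thesis by (simp add: emeasure_le_1)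
    next
      case False
      have "{\<omega> \<in> space M. t < f \<omega>} \<subseteq> {\<omega> \<in> space M. W 1 \<omega> > real t powr (1 / a)}"
      proof safe
        fix \<omega> assume "t < f \<omega>"
        then have t: "real t < max 0 (W 1 \<omega>) powr a"
          unfolding f_def by linarith
        then have W: "W 1 \<omega> > 0" by (cases "W 1 \<omega> > 0") auto
        have "real t powr (1 / a) < (max 0 (W 1 \<omega>) powr a) powr (1 / a)"
          using t a by (intro powr_less_mono2) auto
        also have "\<dots> = W 1 \<omega>" using W a by (simp add: powr_powr)
        finally show "real t powr (1 / a) < W 1 \<omega>" .
      qed
      then have "emeasure M {\<omega> \<in> space M. t < f \<omega>} \<le>
          ennreal (prob {\<omega> \<in> space M. W 1 \<omega> > real t powr (1 / a)})"
        unfolding emeasure_eq_measure[symmetric] by (intro emeasure_mono) auto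
      also have "\<dots> \<le> ennreal (K * (real t powr (1 / a)) powr (- \<beta>))"
        unfolding prob_W_gt using False by (intro ennreal_leI K(2)) auto
      also have "(real t powr (1 / a)) powr (- \<beta>) = real t powr (- \<beta> / a)"
        by (simp add: powr_powr)
      finally show ?thesis using False by simp
    qed
  qed auto
  also have "\<dots> < \<infinity>"
  proof -
    have "summable (\<lambda>t::nat. K * real t powr (- \<beta> / a))"
      using a by (intro summable_mult) (simp add: summable_real_powr_iff field_simps)
    then have "summable (\<lambda>t::nat. if t = 0 then 1 else K * real t powr (- \<beta> / a))"
      by (subst summable_cong[where g = "\<lambda>t. K * real t powr (- \<beta> / a)"])
         (auto intro: eventually_mono[OF eventually_gt_at_top[of 0]])
    then have "(\<Sum>t. ennreal (if t = 0 then 1 else K * real t powr (- \<beta> / a))) \<noteq> \<infinity>"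
      using K(1) by (subst suminf_ennreal2) auto
    then show ?thesis by (simp add: top.not_eq_extremum)
  qed
  finally show ?thesis by (intro integrableI_bounded) auto
qed

text \<open>Each value of \<open>W 1\<close> is within \<open>j powr a + B\<close> of \<open>j * \<mu>\<close> for only \<open>O(1 + W 1 powr a)\<close>
  many \<open>j\<close>, and this has finite expectation.\<close>

lemma summable_prob_W_near:
  assumes tail: "light_tail \<beta>" and a: "0 < a" "a < \<beta>" "\<beta> < 1" and "\<mu> > 0" "B \<ge> 0"
  shows "summable (\<lambda>j. \<P>(\<omega> in M. \<bar>W 1 \<omega> - real j * \<mu>\<bar> \<le> real j powr a + B))"
proof -
  have [measurable]: "W (Suc 0) \<in> borel_measurable M" using W_measurable[of 1] by simp
  define E where "E j = {\<omega> \<in> space M. \<bar>W 1 \<omega> - real j * \<mu>\<bar> \<le> real j powr a + B}" for j :: nat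
  have mE: "E j \<in> events" for j unfolding E_def by simp
  \<comment> \<open>The slope \<open>\<mu> / 4\<close> is chosen so that for \<open>j > j0\<close>,
    where \<open>B + B'\<close> is at most \<open>j * \<mu> / 4\<close>, closeness of
    \<open>W 1\<close> to \<open>j * \<mu>\<close> forces \<open>W 1 \<ge> j * \<mu> / 2\<close>.
    Then \<open>j powr a\<close> can be replaced by a multiple of \<open>W 1 powr a\<close>.\<close>
  obtain B' where B': "B' \<ge> 0" "\<And>j::nat. real j powr a \<le> B' + real j * (\<mu> / 4)"
    using powr_le_affine[of a "\<mu> / 4"] a \<open>\<mu> > 0\<close> by auto
  obtain j0 :: nat where j0: "real j0 \<ge> 4 * (B + B') / \<mu>" using real_arch_simple by blast
  \<comment> \<open>The bound of \<open>card_near_le\<close> with spacing \<open>\<mu>\<close> and a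
    radius that no longer depends on \<open>j\<close>.\<close>
  define g where "g \<omega> = 2 * ((2 / \<mu>) powr a * max 0 (W 1 \<omega>) powr a + B) / \<mu> + 1" for \<omega>
  have g_int: "integrable M g"
    unfolding g_def using integrable_W_powr[OF tail a(1,2)] by simp
  have count: "(\<Sum>j\<in>{Suc j0..<N}. indicator (E j) \<omega> :: real) \<le> g \<omega>" if "\<omega> \<in> space M" for N \<omega>
  proof -
    let ?J = "{j \<in> {Suc j0..<N}. \<omega> \<in> E j}"
    let ?r = "(2 / \<mu>) powr a * max 0 (W 1 \<omega>) powr a + B"
    have "(\<Sum>j\<in>{Suc j0..<N}. indicator (E j) \<omega> :: real) = real (card ?J)"
      by (simp add: indicator_def sum.If_cases Int_def)
    also have "\<dots> \<le> 2 * ?r / \<mu> + 1"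
    proof (rule card_near_le)
      fix j assume "j \<in> ?J"
      then have j: "j > j0" "\<bar>W 1 \<omega> - real j * \<mu>\<bar> \<le> real j powr a + B" by (auto simp: E_def)
      have "real j * \<mu> \<ge> 4 * (B + B')"
      proof -
        have "4 * (B + B') / \<mu> \<le> real j" using j(1) j0 by linarith
        then show ?thesis using \<open>\<mu> > 0\<close> by (simp add: field_simps)
      qed
      then have "W 1 \<omega> \<ge> real j * \<mu> / 2" using j(2) B'(2)[of j] by (simp add: abs_le_iff)
      then have "real j \<le> 2 / \<mu> * max 0 (W 1 \<omega>)" using \<open>\<mu> > 0\<close> by (simp add: field_simps max_def)
      then have "real j powr a \<le> (2 / \<mu> * max 0 (W 1 \<omega>)) powr a" using a by (intro powr_mono2) auto
      also have "\<dots> = (2 / \<mu>) powr a * max 0 (W 1 \<omega>) powr a"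
        by (rule powr_mult)
      finally show "\<bar>W 1 \<omega> - real j * \<mu>\<bar> \<le> ?r" using j(2) by simp
    qed (use \<open>\<mu> > 0\<close> \<open>B \<ge> 0\<close> in auto)
    finally show ?thesis by (simp add: g_def)
  qed
  have "summable (\<lambda>j. prob (E j))"
  proof (rule summableI_nonneg_bounded)
    fix N
    have "(\<Sum>j<N. prob (E j)) \<le> (\<Sum>j\<in>{..j0} \<union> {Suc j0..<N}. prob (E j))"
      by (intro sum_mono2) auto
    also have "\<dots> = (\<Sum>j\<le>j0. prob (E j)) + (\<Sum>j\<in>{Suc j0..<N}. prob (E j))"
      by (intro sum.union_disjoint) auto
    also have "(\<Sum>j\<in>{Suc j0..<N}. prob (E j)) = expectation (\<lambda>\<omega>. \<Sum>j\<in>{Suc j0..<N}. indicator (E j) \<omega>)"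
      using mE by (subst Bochner_Integration.integral_sum) (auto simp: less_top[symmetric])
    also have "\<dots> \<le> expectation g"
      using count mE g_int
      by (intro integral_mono) (auto intro!: Bochner_Integration.integrable_sum simp: less_top[symmetric])
    finally show "(\<Sum>j<N. prob (E j)) \<le> (\<Sum>j\<le>j0. prob (E j)) + expectation g" by simp
  qed simp
  then show ?thesis by (simp add: E_def)
qed

text \<open>\<open>F (u j)\<close> exceeds \<open>F (v j)\<close> by at most the probability
  \<open>e j\<close> that \<open>W 1\<close> falls near \<open>j * \<mu>\<close>. Since
  \<open>F (v j) \<ge> p\<close>, this is a relative error of at most \<open>e j / p\<close>, and
  the \<open>e j\<close> are summable, so the errors multiply to at most
  \<open>exp (suminf e / p)\<close>.\<close>

lemma prod_F_comparable:
  assumes tail: "light_tail \<beta>" and a: "0 < a" "a < \<beta>" "\<beta> < 1" and "\<mu> > 0"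
    and p: "p > 0" "\<And>j. F (v j) \<ge> p"
    and u: "\<And>j. \<bar>u j - real j * \<mu>\<bar> \<le> real j powr a + B"
    and v: "\<And>j. \<bar>v j - real j * \<mu>\<bar> \<le> real j powr a + B"
  shows "\<exists>K>0. \<forall>n. (\<Prod>j<n. F (u j)) \<le> K * (\<Prod>j<n. F (v j))"
proof -
  have [measurable]: "W (Suc 0) \<in> borel_measurable M" using W_measurable[of 1] by simp
  have "B \<ge> 0" using u[of 0] a by (auto simp: abs_le_iff intro: order_trans[OF abs_ge_zero])
  define e where "e j = \<P>(\<omega> in M. \<bar>W 1 \<omega> - real j * \<mu>\<bar> \<le> real j powr a + B)" for j :: nat
  have e: "summable e" "\<And>j. e j \<ge> 0"
    unfolding e_def using summable_prob_W_near[OF tail a \<open>\<mu> > 0\<close> \<open>B \<ge> 0\<close>] by auto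
  have step: "F (u j) \<le> F (v j) * exp (e j / p)" for j
  proof -
    have "F (u j) \<le> prob ({\<omega> \<in> space M. W 1 \<omega> \<le> v j} \<union>
        {\<omega> \<in> space M. \<bar>W 1 \<omega> - real j * \<mu>\<bar> \<le> real j powr a + B})"
      unfolding F_def using u[of j] v[of j]
      by (intro finite_measure_mono) (auto simp: abs_le_iff)
    also have "\<dots> \<le> F (v j) + e j"
      unfolding F_def e_def by (intro measure_subadditive) auto
    also have "e j \<le> F (v j) * (e j / p)"
    proof -
      have "p * (e j / p) \<le> F (v j) * (e j / p)" using p e(2) by (intro mult_right_mono) auto
      then show ?thesis using p(1) by simp
    qed
    also have "F (v j) + F (v j) * (e j / p) = F (v j) * (1 + e j / p)" by (simp add: algebra_simps)
    also have "\<dots> \<le> F (v j) * exp (e j / p)" using F_nonneg by (intro mult_left_mono) auto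
    finally show ?thesis by simp
  qed
  have "(\<Prod>j<n. F (u j)) \<le> exp (suminf e / p) * (\<Prod>j<n. F (v j))" for n
  proof -
    have "(\<Prod>j<n. F (u j)) \<le> (\<Prod>j<n. F (v j) * exp (e j / p))"
      using step F_nonneg by (intro prod_mono) auto
    also have "\<dots> = exp ((\<Sum>j<n. e j) / p) * (\<Prod>j<n. F (v j))"
      by (simp add: prod.distrib exp_sum sum_divide_distrib)
    also have "\<dots> \<le> exp (suminf e / p) * (\<Prod>j<n. F (v j))"
      using e p(1) F_nonneg
      by (intro mult_right_mono prod_nonneg) (auto intro!: divide_right_mono sum_le_suminf)
    finally show ?thesis .
  qed
  then show ?thesis by (intro exI[of _ "exp (suminf e / p)"]) auto
qed

section \<open>Return probabilities against the unperturbed product\<close>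

lemma return_prob_nonneg: "0 \<le> return_prob b n"
  unfolding return_prob_def by simp

lemma return_prob_mono: "b \<le> b' \<Longrightarrow> return_prob b n \<le> return_prob b' n"
  unfolding return_prob_def by (intro finite_measure_mono) auto

lemma U_deviation_powr:
  assumes "k \<le> n"
  shows "\<P>(\<omega> in M. U n k \<omega> > real k * \<mu> + real k powr a) \<le>
           exp (- (1 / (2 * C\<^sup>2)) * real k powr (2 * a - 1))"
    and "\<P>(\<omega> in M. U n k \<omega> < real k * \<mu> - real k powr a) \<le>
           exp (- (1 / (2 * C\<^sup>2)) * real k powr (2 * a - 1))"
proof -
  note [measurable] = U_measurable[OF assms]
  \<comment> \<open>At \<open>k = 0\<close> both sides are \<open>0\<close>, by the conventions for
    division by zero and for \<open>0 powr _\<close>.\<close>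
  have "(real k powr a)\<^sup>2 / real k = real k powr (2 * a - 1)"
  proof (cases "k = 0")
    case False
    have "(real k powr a)\<^sup>2 = real k powr (2 * a)"
      by (simp add: power2_eq_square powr_add[symmetric])
    then show ?thesis using False by (simp add: powr_diff)
  qed simp
  moreover have "- (real k powr a)\<^sup>2 / (2 * C\<^sup>2 * real k) =
      - (1 / (2 * C\<^sup>2)) * ((real k powr a)\<^sup>2 / real k)"
    by simp
  ultimately have eq: "- (real k powr a)\<^sup>2 / (2 * C\<^sup>2 * real k) =
      - (1 / (2 * C\<^sup>2)) * real k powr (2 * a - 1)"
    by (simp only:)
  have "\<P>(\<omega> in M. U n k \<omega> > real k * \<mu> + real k powr a) \<le>
      \<P>(\<omega> in M. U n k \<omega> \<ge> real k * \<mu> + real k powr a)"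
    by (intro finite_measure_mono) auto
  also have "\<dots> \<le> exp (- (1 / (2 * C\<^sup>2)) * real k powr (2 * a - 1))"
    using U_deviation(1)[OF assms, of "real k powr a"] unfolding eq by simp
  finally show "\<P>(\<omega> in M. U n k \<omega> > real k * \<mu> + real k powr a) \<le>
      exp (- (1 / (2 * C\<^sup>2)) * real k powr (2 * a - 1))" .
  have "\<P>(\<omega> in M. U n k \<omega> < real k * \<mu> - real k powr a) \<le>
      \<P>(\<omega> in M. U n k \<omega> \<le> real k * \<mu> - real k powr a)"
    by (intro finite_measure_mono) auto
  also have "\<dots> \<le> exp (- (1 / (2 * C\<^sup>2)) * real k powr (2 * a - 1))"
    using U_deviation(2)[OF assms, of "real k powr a"] unfolding eq by simp
  finally show "\<P>(\<omega> in M. U n k \<omega> < real k * \<mu> - real k powr a) \<le>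
      exp (- (1 / (2 * C\<^sup>2)) * real k powr (2 * a - 1))" .
qed

text \<open>The upper union bound is applied along \<open>h j = j * \<mu> + j powr a\<close>. Its
  products dominate the unperturbed one, so the costs are dominated by the summable
  \<open>s\<close>; \<open>prod_F_comparable\<close> then removes the perturbation.\<close>

lemma light_tail_upper:
  assumes tail: "light_tail \<beta>" and \<beta>: "2 / 3 < \<beta>" "\<beta> < 1"
    and \<mu>: "\<mu> > 0" and y: "y > 0" "F y > 0"
  shows "\<exists>K>0. \<forall>n. return_prob b n \<le> K * (\<Prod>j<n. F (y + real j * \<mu>))"
proof -
  \<comment> \<open>The midpoint of the interval from \<open>1 - \<beta> / 2\<close> to
    \<open>\<beta>\<close>, which is nonempty exactly when \<open>\<beta> > 2 / 3\<close>.\<close>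
  define a where "a = (1 + \<beta> / 2) / 2"
  have a: "0 < a" "a < \<beta>" "1 - \<beta> < 2 * a - 1" using \<beta> by (auto simp: a_def field_simps)
  \<comment> \<open>Raising \<open>b\<close> to at least \<open>y\<close> keeps the factors along
    the barrier positive; \<open>return_prob\<close> only grows.\<close>
  define b' where "b' = max b y"
  define h where "h j = real j * \<mu> + real j powr a" for j :: nat
  define c where "c = 1 / (2 * C\<^sup>2)"
  have c: "c > 0" using C_pos by (simp add: c_def)
  define s where "s k = exp (- c * real k powr (2 * a - 1)) / (\<Prod>j\<le>k. F (y + real j * \<mu>))" for k :: nat
  have s_sum: "summable s"
    unfolding s_def by (rule summable_deviation_ratio[OF tail _ \<beta>(2) a(3) y \<mu> c]) (use \<beta> in auto)
  have Fy: "F y \<le> F (y + real j * \<mu>)" for j :: nat using \<mu> by (intro F_mono) auto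
  have Fpos: "0 < F (y + real j * \<mu>)" for j :: nat using y(2) Fy by (rule less_le_trans)
  have s_nonneg: "s k \<ge> 0" for k unfolding s_def using F_nonneg by (auto intro!: divide_nonneg_nonneg prod_nonneg)
  have le: "F (y + real j * \<mu>) \<le> F (b' + h j)" for j :: nat
    using max.cobounded2[of y b] powr_ge_zero[of "real j" a]
    unfolding b'_def h_def by (intro F_mono) linarith
  have qpos: "F (b' + h j) > 0" for j using Fpos le by (rule less_le_trans)
  obtain K where K: "K > 0" "\<And>n. (\<Prod>j<n. F (b' + h j)) \<le> K * (\<Prod>j<n. F (y + real j * \<mu>))"
  proof -
    have "\<exists>K>0. \<forall>n. (\<Prod>j<n. F (b' + h j)) \<le> K * (\<Prod>j<n. F (y + real j * \<mu>))"
    proof (rule prod_F_comparable[OF tail a(1,2) \<beta>(2) \<mu> y(2) Fy])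
      fix j :: nat
      have "b' \<ge> y" by (simp add: b'_def)
      moreover have "real j powr a \<ge> 0" by simp
      ultimately show "\<bar>b' + h j - real j * \<mu>\<bar> \<le> real j powr a + b'"
        "\<bar>y + real j * \<mu> - real j * \<mu>\<bar> \<le> real j powr a + b'"
        using y unfolding h_def by linarith+
    qed
    then show ?thesis using that by blast
  qed
  have "return_prob b n \<le> (1 + suminf s) * K * (\<Prod>j<n. F (y + real j * \<mu>))" for n
  proof -
    have "return_prob b n \<le> return_prob b' n" by (rule return_prob_mono) (simp add: b'_def)
    also have "\<dots> \<le> (\<Prod>j<n. F (b' + h j)) *
        (1 + (\<Sum>k<n. exp (- c * real k powr (2 * a - 1)) / (\<Prod>j\<le>k. F (b' + h j))))"
      using U_deviation_powr(1)
      by (intro return_prob_upper order_refl qpos) (auto simp: h_def c_def)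
    also have "(\<Sum>k<n. exp (- c * real k powr (2 * a - 1)) / (\<Prod>j\<le>k. F (b' + h j))) \<le> (\<Sum>k<n. s k)"
      unfolding s_def
      by (intro sum_mono divide_left_mono prod_mono mult_pos_pos prod_pos conjI)
         (use le Fpos qpos F_nonneg in auto)
    also have "(\<Sum>k<n. s k) \<le> suminf s"
      using s_sum s_nonneg by (intro sum_le_suminf) auto
    also have "(\<Prod>j<n. F (b' + h j)) * (1 + suminf s) \<le> (K * (\<Prod>j<n. F (y + real j * \<mu>))) * (1 + suminf s)"
      using K(2) suminf_nonneg[OF s_sum s_nonneg] by (intro mult_right_mono) auto
    finally show ?thesis using F_nonneg by (simp add: mult_ac prod_nonneg mult_left_mono mult_right_mono)
  qed
  moreover have "(1 + suminf s) * K > 0"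
    using K(1) suminf_nonneg[OF s_sum s_nonneg] by (intro mult_pos_pos) auto
  ultimately show ?thesis by blast
qed

text \<open>The lower union bound needs a total cost below \<open>1\<close>. The cost from a large
  \<open>N\<close> on is the tail of a convergent series, and a large \<open>b\<close> makes the
  deviations before \<open>N\<close> impossible.\<close>

lemma light_tail_lower:
  assumes tail: "light_tail \<beta>" and \<beta>: "2 / 3 < \<beta>" "\<beta> < 1"
    and \<mu>: "\<mu> > 0" and y: "y > 0" "F y > 0"
  shows "\<exists>b>0. \<exists>K>0. \<forall>n. (\<Prod>j<n. F (y + real j * \<mu>)) \<le> K * return_prob b n"
proof -
  define a where "a = (1 + \<beta> / 2) / 2"
  have a: "0 < a" "a < \<beta>" "a < 1" "1 - \<beta> < 2 * a - 1" using \<beta> by (auto simp: a_def field_simps)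
  \<comment> \<open>Adding \<open>B\<close> keeps the lowered barrier \<open>v\<close> above the
    line \<open>y + j * (\<mu> / 2)\<close>, so \<open>v\<close> is nonnegative and
    \<open>F (v j) \<ge> F y\<close> for all \<open>j\<close>.\<close>
  obtain B where B: "B \<ge> 0" "\<And>j::nat. real j powr a \<le> B + real j * (\<mu> / 2)"
    using powr_le_affine[of a "\<mu> / 2"] a \<mu> by auto
  define v where "v j = y + B + real j * \<mu> - real j powr a" for j :: nat
  have v: "v j \<ge> y + real j * (\<mu> / 2)" for j using B(2)[of j] by (simp add: v_def field_simps)
  define c where "c = 1 / (2 * C\<^sup>2)"
  have c: "c > 0" using C_pos by (simp add: c_def)
  define d where "d k = exp (- c * real k powr (2 * a - 1))" for k :: nat
  define s where "s k = d k / (\<Prod>j\<le>k. F (y + real j * (\<mu> / 2)))" for k :: nat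
  have s_sum: "summable s"
    unfolding s_def d_def
    by (rule summable_deviation_ratio[OF tail _ \<beta>(2) a(4) y _ c]) (use \<beta> \<mu> in auto)
  have Fy: "F y \<le> F (y + real j * (\<mu> / 2))" for j :: nat using \<mu> by (intro F_mono) auto
  have Fpos: "0 < F (y + real j * (\<mu> / 2))" for j :: nat using y(2) Fy by (rule less_le_trans)
  have le: "F (y + real j * (\<mu> / 2)) \<le> F (v j)" for j by (intro F_mono v)
  have vpos: "F (v j) > 0" for j using Fpos le by (rule less_le_trans)
  have Fyv: "F y \<le> F (v j)" for j using Fy le by (rule order_trans)
  obtain N where N: "\<And>m n. m \<ge> N \<Longrightarrow> norm (sum s {m..<n}) < 1 / 2"
    using s_sum unfolding summable_Cauchy by (metis half_gt_zero_iff zero_less_one)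
  \<comment> \<open>For \<open>k < N\<close> this gives \<open>v k - b \<le> - C * k\<close>, a
    level that \<open>U n k\<close> almost surely does not undercut. There is no circularity:
    \<open>v\<close>, \<open>s\<close> and hence \<open>N\<close> do not involve
    \<open>b\<close>.\<close>
  define b where "b = y + B + real N * (\<mu> + C)"
  have b: "b > 0" using y B \<mu> C_pos by (simp add: b_def add_pos_nonneg)
  define \<delta> where "\<delta> k = (if k < N then 0 else d k)" for k
  have \<delta>: "\<P>(\<omega> in M. U n k \<omega> < v k - b) \<le> \<delta> k" if "k \<le> n" for n k
  proof -
    note [measurable] = U_measurable[OF that]
    show ?thesis
    proof (cases "k < N")
      case True
      have "real k * (\<mu> + C) \<le> real N * (\<mu> + C)"
        using True \<mu> C_pos by (intro mult_right_mono) auto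
      then have "v k - b \<le> - (real k * C)"
        using powr_ge_zero[of "real k" a] unfolding v_def b_def distrib_left by linarith
      then have low: "v k - b \<le> - C * real k" by (simp add: mult.commute)
      have "AE \<omega> in M. \<not> U n k \<omega> < v k - b"
        using AE_U_ge[OF that] by eventually_elim (use low in linarith)
      then have "\<P>(\<omega> in M. U n k \<omega> < v k - b) = 0" by (subst prob_eq_0) auto
      then show ?thesis using True by (simp add: \<delta>_def)
    next
      case False
      have "real N * (\<mu> + C) \<ge> 0" using \<mu> C_pos by simp
      then have "\<P>(\<omega> in M. U n k \<omega> < v k - b) \<le> \<P>(\<omega> in M. U n k \<omega> < real k * \<mu> - real k powr a)"
        by (intro finite_measure_mono) (auto simp: v_def b_def)
      also have "\<dots> \<le> d k" using U_deviation_powr(2)[OF that, of a] by (simp add: d_def c_def)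
      finally show ?thesis using False by (simp add: \<delta>_def)
    qed
  qed
  have half: "(\<Sum>k\<le>n. \<delta> k / (\<Prod>j<k. F (v j))) \<le> 1 / 2" for n
  proof -
    have "(\<Sum>k\<le>n. \<delta> k / (\<Prod>j<k. F (v j))) = (\<Sum>k\<in>{N..<Suc n}. \<delta> k / (\<Prod>j<k. F (v j)))"
      by (intro sum.mono_neutral_right) (auto simp: \<delta>_def)
    also have "\<dots> \<le> (\<Sum>k\<in>{N..<Suc n}. s k)"
    proof (rule sum_mono)
      fix k assume "k \<in> {N..<Suc n}"
      \<comment> \<open>The union bound divides by the factors with \<open>j < k\<close>, but
        \<open>s\<close> by those with \<open>j \<le> k\<close>; the extra factor is at most
        \<open>1\<close>.\<close>
      have "(\<Prod>j\<le>k. F (y + real j * (\<mu> / 2))) \<le> (\<Prod>j<k. F (y + real j * (\<mu> / 2))) * 1"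
        unfolding lessThan_Suc_atMost[symmetric] prod.lessThan_Suc
        using F_le_1 F_nonneg by (intro mult_left_mono prod_nonneg) auto
      also have "\<dots> \<le> (\<Prod>j<k. F (v j))"
        using le F_nonneg by (simp add: prod_mono)
      finally show "\<delta> k / (\<Prod>j<k. F (v j)) \<le> s k"
        unfolding s_def using \<open>k \<in> _\<close> Fpos vpos
        by (auto simp: \<delta>_def d_def intro!: divide_left_mono mult_pos_pos prod_pos)
    qed
    also have "\<dots> \<le> 1 / 2" using N[of N "Suc n"] by (simp add: abs_less_iff)
    finally show ?thesis .
  qed
  have low: "(\<Prod>j<n. F (v j)) \<le> 2 * return_prob b n" for n
  proof -
    have "v j \<ge> 0" for j using v[of j] y \<mu> by (smt (verit) mult_nonneg_nonneg of_nat_0_le_iff half_gt_zero)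
    from return_prob_lower[of v b \<delta> n, OF this vpos \<delta>]
    have "(\<Prod>j<n. F (v j)) * (1 - (\<Sum>k\<le>n. \<delta> k / (\<Prod>j<k. F (v j)))) \<le> return_prob b n" by simp
    moreover have "(\<Prod>j<n. F (v j)) * (1 / 2) \<le>
        (\<Prod>j<n. F (v j)) * (1 - (\<Sum>k\<le>n. \<delta> k / (\<Prod>j<k. F (v j))))"
      using half[of n] F_nonneg by (intro mult_left_mono prod_nonneg) auto
    ultimately show ?thesis by simp
  qed
  have "\<exists>K>0. \<forall>n. (\<Prod>j<n. F (y + real j * \<mu>)) \<le> K * (\<Prod>j<n. F (v j))"
  proof (rule prod_F_comparable[OF tail a(1,2) \<beta>(2) \<mu> y(2) Fyv])
    fix j :: nat
    have "real j powr a \<ge> 0" by simp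
    then show "\<bar>y + real j * \<mu> - real j * \<mu>\<bar> \<le> real j powr a + (y + B)"
      "\<bar>v j - real j * \<mu>\<bar> \<le> real j powr a + (y + B)"
      using y B(1) unfolding v_def by linarith+
  qed
  then obtain K where K: "K > 0" "\<And>n. (\<Prod>j<n. F (y + real j * \<mu>)) \<le> K * (\<Prod>j<n. F (v j))" by blast
  have "(\<Prod>j<n. F (y + real j * \<mu>)) \<le> (K * 2) * return_prob b n" for n
  proof -
    have "K * (\<Prod>j<n. F (v j)) \<le> K * (2 * return_prob b n)"
      using low[of n] K(1) by (intro mult_left_mono) auto
    then show ?thesis using K(2)[of n] by simp
  qed
  then show ?thesis using b K(1) by (intro exI[of _ b] conjI exI[of _ "K * 2"]) auto
qed

subsection \<open>Heavy tails\<close>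

text \<open>Along a slope \<open>\<eta> > \<mu>\<close> the deviations are linear and cost only
  \<open>exp (- \<kappa> * k)\<close>. If also \<open>\<eta> < L\<close>, the factors
  \<open>F (b + j * \<eta>)\<close> are eventually at most \<open>1 - \<theta> / (j + 1)\<close>
  with \<open>\<theta> > 1\<close>, so their product is of order at most
  \<open>n powr (- \<theta>)\<close> and summable.\<close>

lemma heavy_tail_summable:
  assumes L: "\<mu> < L" "\<And>x. x \<ge> x0 \<Longrightarrow> x * (1 - F x) \<ge> L" and \<mu>: "\<mu> > 0" and b: "b > 0"
  shows "summable (return_prob b)" and "summable (\<lambda>n. \<Prod>j<n. F (b + real j * \<mu>))"
proof -
  define \<eta> where "\<eta> = (\<mu> + L) / 2"
  have \<eta>: "\<mu> < \<eta>" "\<eta> < L" "\<eta> > 0" using L(1) \<mu> by (auto simp: \<eta>_def)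
  \<comment> \<open>The midpoint of \<open>1\<close> and \<open>L / \<eta>\<close>.\<close>
  define \<theta> where "\<theta> = (1 + L / \<eta>) / 2"
  have \<theta>: "\<theta> > 1" "\<theta> * \<eta> < L" using \<eta> by (auto simp: \<theta>_def field_simps)
  \<comment> \<open>Majorises \<open>1 - \<theta> / (j + 1)\<close> by a positive factor whose
    product telescopes.\<close>
  define r where "r j = ((real j + 1) / (real j + 2)) powr \<theta>" for j :: nat
  have r: "0 < r j" "r j \<le> 1" "1 - \<theta> / (real j + 1) \<le> r j" for j
  proof -
    show "0 < r j" by (simp add: r_def)
    show "r j \<le> 1" unfolding r_def using \<theta> by (intro powr_le1) auto
    have "(real j + 1) / (real j + 2) = 1 / (1 + 1 / (real j + 1))" by (simp add: field_simps)
    also have "\<dots> \<ge> 1 / exp (1 / (real j + 1))"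
      by (intro divide_left_mono exp_ge_add_one_self mult_pos_pos add_pos_pos) auto
    finally have "exp (- (1 / (real j + 1))) \<le> (real j + 1) / (real j + 2)"
      by (simp add: exp_minus field_simps)
    then have "exp (- (1 / (real j + 1))) powr \<theta> \<le> r j"
      unfolding r_def using \<theta> by (intro powr_mono2) auto
    also have "exp (- (1 / (real j + 1))) powr \<theta> = exp (- (\<theta> / (real j + 1)))"
      by (simp add: powr_def)
    finally show "1 - \<theta> / (real j + 1) \<le> r j"
      using exp_ge_add_one_self[of "- (\<theta> / (real j + 1))"] by linarith
  qed
  \<comment> \<open>The first bound brings \<open>b + j * \<eta>\<close> beyond \<open>x0\<close>;
    the second gives \<open>\<theta> * (b + j * \<eta>) \<le> L * j\<close>, which absorbs the
    offset \<open>b\<close>.\<close>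
  obtain j0 :: nat where j0: "real j0 \<ge> max (x0 / \<eta>) (\<theta> * b / (L - \<theta> * \<eta>))"
    using real_arch_simple by blast
  define q where "q j = (if j < j0 then 1 else r j)" for j
  have q: "0 < q j" "r j \<le> q j" for j using r by (auto simp: q_def)
  have Fq: "F (b + real j * \<eta>) \<le> q j" for j
  proof (cases "j < j0")
    case True
    then show ?thesis by (simp add: q_def F_le_1)
  next
    case False
    define x where "x = b + real j * \<eta>"
    have x: "x > 0" unfolding x_def using b \<eta> by (intro add_pos_nonneg) auto
    have j: "real j \<ge> x0 / \<eta>" "real j \<ge> \<theta> * b / (L - \<theta> * \<eta>)" using False j0 by linarith+
    have "x \<ge> x0" using j(1) \<eta> b by (simp add: x_def field_simps)
    then have "L / x \<le> 1 - F x" using L(2)[of x] x by (simp add: field_simps)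
    moreover have "\<theta> / (real j + 1) \<le> L / x"
    proof -
      have "\<theta> * b \<le> real j * (L - \<theta> * \<eta>)" using j(2) \<theta> by (simp add: field_simps)
      then have "\<theta> * x \<le> L * (real j + 1)" using \<eta> by (simp add: x_def algebra_simps)
      then show ?thesis using x by (simp add: field_simps)
    qed
    ultimately have "F x \<le> r j" using r(3)[of j] by linarith
    then show ?thesis using False by (simp add: q_def x_def)
  qed
  have prod_r: "(\<Prod>j\<le>k. r j) = (1 / (real k + 2)) powr \<theta>" for k
    by (induction k) (simp_all add: r_def powr_mult[symmetric] field_simps)
  have prod_q: "(\<Prod>j<n. q j) \<le> ((real j0 + 1) / (real n + 1)) powr \<theta>" for n
  proof (cases "n \<le> j0")
    case True
    then have "(\<Prod>j<n. q j) = 1" by (intro prod.neutral) (auto simp: q_def)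
    moreover have "1 \<le> ((real j0 + 1) / (real n + 1)) powr \<theta>"
      using True \<theta> by (intro ge_one_powr_ge_zero) auto
    ultimately show ?thesis by simp
  next
    case False
    then have "j0 \<le> n" by simp
    then show ?thesis
    proof (induction n rule: dec_induct)
      case base
      have "(\<Prod>j<j0. q j) = 1" by (intro prod.neutral) (auto simp: q_def)
      then show ?case by simp
    next
      case (step n)
      have "(\<Prod>j<Suc n. q j) \<le> ((real j0 + 1) / (real n + 1)) powr \<theta> * r n"
        using step r(1)[of n] by (simp add: q_def)
      also have "\<dots> = ((real j0 + 1) / (real (Suc n) + 1)) powr \<theta>"
      proof -
        have "(real j0 + 1) / (real n + 1) * ((real n + 1) / (real n + 2)) =
            (real j0 + 1) / (real (Suc n) + 1)"
          by (simp add: add_ac)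
        then show ?thesis unfolding r_def by (simp only: powr_mult[symmetric])
      qed
      finally show ?case .
    qed
  qed
  have sum_q: "summable (\<lambda>n. \<Prod>j<n. q j)"
  proof (rule summable_comparison_test_bigo)
    show "summable (\<lambda>n. norm (real n powr - \<theta>))"
      using \<theta> by (simp add: summable_real_powr_iff)
    have "(\<lambda>n. \<Prod>j<n. q j) \<in> O(\<lambda>n. ((real j0 + 1) / (real n + 1)) powr \<theta>)"
      using prod_q q(1) by (intro landau_o.big_mono always_eventually allI) (simp add: prod_nonneg less_imp_le)
    also have "(\<lambda>n::nat. ((real j0 + 1) / (real n + 1)) powr \<theta>) \<in> O(\<lambda>n. real n powr - \<theta>)"
      using \<theta> by real_asymp
    finally show "(\<lambda>n. \<Prod>j<n. q j) \<in> O(\<lambda>n. real n powr - \<theta>)" .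
  qed
  define \<kappa> where "\<kappa> = (\<eta> - \<mu>)\<^sup>2 / (2 * C\<^sup>2)"
  have \<kappa>: "\<kappa> > 0" using \<eta> C_pos by (simp add: \<kappa>_def)
  \<comment> \<open>Dividing by a product of order \<open>k powr (- \<theta>)\<close> costs only a
    polynomial factor, against which the exponential still wins.\<close>
  define s where "s k = exp (- \<kappa> * real k) * (real k + 2) powr \<theta>" for k :: nat
  have s_sum: "summable s"
  proof (rule summable_comparison_test_bigo)
    show "summable (\<lambda>k. norm (1 / real k ^ 2))"
      using inverse_power_summable[of 2, where 'a = real] by (simp add: field_simps)
    show "s \<in> O(\<lambda>k. 1 / real k ^ 2)"
      unfolding s_def using \<kappa> \<theta> by real_asymp
  qed
  have \<delta>: "\<P>(\<omega> in M. U n k \<omega> > real k * \<eta>) \<le> exp (- \<kappa> * real k)" if "k \<le> n" for n k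
  proof -
    note [measurable] = U_measurable[OF that]
    have "\<P>(\<omega> in M. U n k \<omega> > real k * \<eta>) \<le> \<P>(\<omega> in M. U n k \<omega> \<ge> real k * \<mu> + real k * (\<eta> - \<mu>))"
      by (intro finite_measure_mono) (auto simp: algebra_simps)
    also have "\<dots> \<le> exp (- (real k * (\<eta> - \<mu>))\<^sup>2 / (2 * C\<^sup>2 * real k))"
      using \<eta> by (intro U_deviation that) auto
    also have "(real k * (\<eta> - \<mu>))\<^sup>2 / (2 * C\<^sup>2 * real k) = \<kappa> * real k"
      by (cases "k = 0") (auto simp: \<kappa>_def power2_eq_square)
    then have "- (real k * (\<eta> - \<mu>))\<^sup>2 / (2 * C\<^sup>2 * real k) = - \<kappa> * real k" by simp
    finally show ?thesis .
  qed
  have bound: "return_prob b n \<le> (1 + suminf s) * (\<Prod>j<n. q j)" for n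
  proof -
    have "return_prob b n \<le> (\<Prod>j<n. q j) * (1 + (\<Sum>k<n. exp (- \<kappa> * real k) / (\<Prod>j\<le>k. q j)))"
      using return_prob_upper[of b "\<lambda>j. real j * \<eta>" q, OF Fq q(1) \<delta>] by simp
    also have "(\<Sum>k<n. exp (- \<kappa> * real k) / (\<Prod>j\<le>k. q j)) \<le> (\<Sum>k<n. s k)"
    proof (rule sum_mono)
      fix k
      have "(1 / (real k + 2)) powr \<theta> \<le> (\<Prod>j\<le>k. q j)"
        unfolding prod_r[symmetric] using q(2) r(1) by (intro prod_mono) (auto simp: less_imp_le)
      then have "exp (- \<kappa> * real k) / (\<Prod>j\<le>k. q j) \<le> exp (- \<kappa> * real k) / (1 / (real k + 2)) powr \<theta>"
        using q(1) by (intro divide_left_mono mult_pos_pos prod_pos) auto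
      also have "\<dots> = s k" by (simp add: s_def powr_divide)
      finally show "exp (- \<kappa> * real k) / (\<Prod>j\<le>k. q j) \<le> s k" .
    qed
    also have "(\<Sum>k<n. s k) \<le> suminf s" by (intro sum_le_suminf s_sum) (auto simp: s_def)
    finally show ?thesis using q(1) by (simp add: mult.commute prod_nonneg less_imp_le mult_right_mono)
  qed
  show "summable (return_prob b)"
    by (rule summable_comparison_test'[OF summable_mult[OF sum_q, of "1 + suminf s"], of 0])
       (use bound return_prob_nonneg in auto)
  have "(\<Prod>j<n. F (b + real j * \<mu>)) \<le> (\<Prod>j<n. q j)" for n
  proof (intro prod_mono conjI F_nonneg)
    fix j
    have "F (b + real j * \<mu>) \<le> F (b + real j * \<eta>)"
      using \<eta> by (intro F_mono add_left_mono mult_left_mono) auto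
    then show "F (b + real j * \<mu>) \<le> q j" using Fq[of j] by linarith
  qed
  then show "summable (\<lambda>n. \<Prod>j<n. F (b + real j * \<mu>))"
    by (intro summable_comparison_test'[OF sum_q, of 0]) (auto simp: F_nonneg prod_nonneg)
qed

subsection \<open>Recurrence\<close>

text \<open>For light tails the two series are compared termwise in both directions. For heavy tails
  both sides of the equivalence are false, as every series involved converges.\<close>

theorem recurrent_iff:
  assumes \<mu>: "\<mu> > 0" and y: "y > 0" "F y > 0"
    and \<beta>: "2 / 3 < \<beta>" "\<beta> < 1"
    and tail: "light_tail \<beta> \<or> Liminf at_top (\<lambda>x. ereal (x * (1 - F x))) > ereal \<mu>"
  shows "(\<exists>b>0. \<not> summable (return_prob b)) \<longleftrightarrow> \<not> summable (\<lambda>n. \<Prod>j<n. F (y + real j * \<mu>))"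
  using tail
proof
  assume lt: "light_tail \<beta>"
  note ul = light_tail_upper[OF lt \<beta> \<mu> y] light_tail_lower[OF lt \<beta> \<mu> y]
  let ?P = "\<lambda>n. \<Prod>j<n. F (y + real j * \<mu>)"
  show ?thesis
  proof
    assume "\<exists>b>0. \<not> summable (return_prob b)"
    then obtain b where b: "\<not> summable (return_prob b)" by blast
    obtain K where K: "\<And>n. return_prob b n \<le> K * ?P n" using ul(1)[of b] by blast
    show "\<not> summable ?P"
    proof
      assume "summable ?P"
      from summable_comparison_test'[OF summable_mult[OF this, of K], of 0 "return_prob b"]
      show False using K return_prob_nonneg b by auto
    qed
  next
    assume *: "\<not> summable ?P"
    obtain b K where b: "b > 0" and K: "\<And>n. ?P n \<le> K * return_prob b n" using ul(2) by blast
    have "\<not> summable (return_prob b)"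
    proof
      assume "summable (return_prob b)"
      from summable_comparison_test'[OF summable_mult[OF this, of K], of 0 ?P]
      show False using K * by (auto simp: prod_nonneg F_nonneg)
    qed
    then show "\<exists>b>0. \<not> summable (return_prob b)" using b by blast
  qed
next
  assume "Liminf at_top (\<lambda>x. ereal (x * (1 - F x))) > ereal \<mu>"
  \<comment> \<open>A value strictly between \<open>\<mu>\<close> and the limit inferior is
    eventually a pointwise lower bound.\<close>
  then obtain L where L: "\<mu> < L" "ereal L < Liminf at_top (\<lambda>x. ereal (x * (1 - F x)))"
    using ereal_dense2 by (metis ereal_less_eq(3) less_ereal.simps(1))
  have "eventually (\<lambda>x. ereal L < ereal (x * (1 - F x))) at_top"
    using L(2) by (rule less_LiminfD)
  then obtain x0 where x0: "\<forall>x\<ge>x0. L < x * (1 - F x)"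
    by (auto simp: eventually_at_top_linorder)
  have "L \<le> x * (1 - F x)" if "x \<ge> x0" for x using x0 that less_imp_le by blast
  from heavy_tail_summable[OF L(1) this \<mu>] show ?thesis using y(1) by blast
qed

end

theorem corollary7:
  fixes M :: "'a measure"
    and W T :: "nat \<Rightarrow> 'a \<Rightarrow> real"
    and y :: real
  assumes "prob_space M"
    and W_rv: "\<And>n. W n \<in> borel_measurable M"
    and W_nonneg: "\<And>n. AE \<omega> in M. 0 \<le> W n \<omega>"
    and W_unbounded: "\<not> bounded (law_support (distr M borel (W 1)))"
    and T_rv: "\<And>n. n \<ge> 1 \<Longrightarrow> T n \<in> borel_measurable M"
    and indep: "prob_space.indep_vars M (\<lambda>_. borel \<Otimes>\<^sub>M borel) (\<lambda>n \<omega>. (T n \<omega>, W n \<omega>)) {1..}"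
    and ident: "\<And>n. n \<ge> 1 \<Longrightarrow>
      distr M (borel \<Otimes>\<^sub>M borel) (\<lambda>\<omega>. (T n \<omega>, W n \<omega>)) =
      distr M (borel \<Otimes>\<^sub>M borel) (\<lambda>\<omega>. (T 1 \<omega>, W 1 \<omega>))"
    and indep_init: "indep_var_hetero M
      (\<Pi>\<^sub>M n\<in>{1..}. borel \<Otimes>\<^sub>M borel) (\<lambda>\<omega>. \<lambda>n\<in>{1..}. (T n \<omega>, W n \<omega>))
      borel (W 0)"
    and T_bounded: "\<exists>C. AE \<omega> in M. \<bar>T 1 \<omega>\<bar> \<le> C"
    and T_mean: "prob_space.expectation M (T 1) > 0"
    and tail: "\<exists>\<beta>. 2 / 3 < \<beta> \<and> \<beta> < 1 \<and>
      (((\<lambda>x. x powr \<beta> * \<P>(\<omega> in M. W 1 \<omega> > x)) \<longlongrightarrow> 0) at_top \<or>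
       Liminf at_top (\<lambda>x. ereal (x * \<P>(\<omega> in M. W 1 \<omega> > x))) > ereal (prob_space.expectation M (T 1)))"
    and "y > 0"
    and "\<P>(\<omega> in M. W 1 \<omega> \<le> y) > 0"
  shows "exchange_recurrent M T W \<longleftrightarrow>
    (\<Sum>n. ennreal (\<Prod>m=0..n. \<P>(\<omega> in M. W 1 \<omega> \<le> y + real m * prob_space.expectation M (T 1)))) = \<infinity>"
proof -
  obtain C where C: "AE \<omega> in M. \<bar>T 1 \<omega>\<bar> \<le> C" using T_bounded by blast
  interpret prob_space M by fact
  \<comment> \<open>The maximum makes the bound positive, as the locale requires.\<close>
  interpret iid_exchange M T W "max 1 C"
  proof unfold_locales
    show "AE \<omega> in M. \<bar>T 1 \<omega>\<bar> \<le> max 1 C"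
      using C by (rule eventually_mono) linarith
  qed (rule indep ident | simp)+
  obtain \<beta> where \<beta>: "2 / 3 < \<beta>" "\<beta> < 1"
    "light_tail \<beta> \<or> Liminf at_top (\<lambda>x. ereal (x * (1 - F x))) > ereal \<mu>"
    using tail unfolding prob_W_gt \<mu>_def[symmetric] light_tail_def[symmetric]
    by (elim exE conjE) (rule that)
  have "exchange_recurrent M T W \<longleftrightarrow> (\<exists>b>0. \<not> summable (return_prob b))"
    unfolding exchange_recurrent_def return_prob_def[symmetric]
    by (simp only: suminf_ennreal_eq_infinity_iff[OF return_prob_nonneg])
  also have "\<dots> \<longleftrightarrow> \<not> summable (\<lambda>n. \<Prod>j<n. F (y + real j * \<mu>))"
    using assms T_mean \<beta> by (intro recurrent_iff) (auto simp: F_def \<mu>_def)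
  \<comment> \<open>The products of the theorem include the factor \<open>m = n\<close>; passing to
    them only drops the empty product at \<open>n = 0\<close> from the series.\<close>
  also have "\<dots> \<longleftrightarrow> \<not> summable (\<lambda>n. \<Prod>j<Suc n. F (y + real j * \<mu>))"
    by (subst summable_Suc_iff) (rule refl)
  also have "\<dots> \<longleftrightarrow> (\<Sum>n. ennreal (\<Prod>m=0..n. F (y + real m * \<mu>))) = \<infinity>"
    unfolding lessThan_Suc_atMost atLeast0AtMost
    by (subst suminf_ennreal_eq_infinity_iff) (auto simp: prod_nonneg F_nonneg)
  finally show ?thesis unfolding F_def \<mu>_def .
qed

end
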